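(* Let $2\le d\le 4$, let $\mathcal{O}\subset\mathbb{R}^d$ be a bounded domain with $C^2$ boundary, let $\mu,\beta>0$ and $r>3$. Let $\mathrm{G}(\boldsymbol{u})=\mu\mathrm{A}\boldsymbol{u}+\mathrm{B}(\boldsymbol{u})+\beta\mathcal{C}(\boldsymbol{u})$ for $\boldsymbol{u}\in\mathbb{V}\cap\widetilde{\mathbb{L}}^{r+1}$. Then for all $\boldsymbol{u},\boldsymbol{v}\in\mathbb{V}\cap\widetilde{\mathbb{L}}^{r+1}$, $$\langle \mathrm{G}(\boldsymbol{u})-\mathrm{G}(\boldsymbol{v}),\boldsymbol{u}-\boldsymbol{v}\rangle+\varrho\|\boldsymbol{u}-\boldsymbol{v}\|_{\mathbb{H}}^2\ge 0,\qquad \varrho=\frac{r-3}{2\mu(r-1)}\left(\frac{2}{\beta\mu(r-1)}\right)^{\frac{2}{r-3}}.$$ That is, $\mathrm{G}+\varrho \mathrm{I}_d$ (with $\mathrm{I}_d$ the identity operator) is a monotone operator from $\mathbb{V}\cap\widetilde{\mathbb{L}}^{r+1}$ to $\mathbb{V}'+\widetilde{\mathbb{L}}^{\frac{r+1}{r}}$.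
   Context: Function spaces: $\mathcal{V}=\{\boldsymbol{u}\in C_0^\infty(\mathcal{O};\mathbb{R}^d):\nabla\cdot\boldsymbol{u}=0\}$. $\mathbb{H}$, $\mathbb{V}$, $\widetilde{\mathbb{L}}^p$ ($2<p<\infty$) are the closures of $\mathcal{V}$ in $L^2(\mathcal{O};\mathbb{R}^d)$, $H_0^1(\mathcal{O};\mathbb{R}^d)$, $L^p(\mathcal{O};\mathbb{R}^d)$ respectively, with norms $\|\boldsymbol u\|_{\mathbb H}=\|\boldsymbol u\|_{L^2}$, $\|\boldsymbol u\|_{\mathbb V}=\|\nabla\boldsymbol u\|_{L^2}$, $\|\boldsymbol u\|_{\widetilde{\mathbb L}^p}=\|\boldsymbol u\|_{L^p}$. $\mathbb{H}$ is identified with its dual. $\mathbb{V}\cap\widetilde{\mathbb{L}}^{p}$ carries the norm $\max\{\|\cdot\|_{\mathbb V},\|\cdot\|_{\widetilde{\mathbb L}^p}\}$; its dual is $\mathbb{V}'+\widetilde{\mathbb{L}}^{p'}$, $\frac1p+\frac1{p'}=1$, where $\widetilde{\mathbb{L}}^{p'}$ denotes the dual of $\widetilde{\mathbb{L}}^{p}$; $\langle\cdot,\cdot\rangle$ is the duality pairing. Operators (as functionals, for $\boldsymbol{u},\boldsymbol v\in\mathbb{V}\cap\widetilde{\mathbb{L}}^{r+1}$, $r\ge3$): $\langle \mathrm{A}\boldsymbol{u},\boldsymbol{v}\rangle=\int_{\mathcal{O}}\nabla\boldsymbol{u}:\nabla\boldsymbol{v}\,dx$; $\mathrm{B}(\boldsymbol{u})=\mathrm{B}(\boldsymbol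 u,\boldsymbol u)$, where $\langle\mathrm{B}(\boldsymbol u,\boldsymbol v),\boldsymbol{w}\rangle=b(\boldsymbol u,\boldsymbol v,\boldsymbol w)=\int_{\mathcal{O}}(\boldsymbol{u}\cdot\nabla)\boldsymbol{v}\cdot\boldsymbol{w}\,dx=-\int_{\mathcal{O}}(\boldsymbol{u}\cdot\nabla)\boldsymbol{w}\cdot\boldsymbol{v}\,dx$ (the last expression defines the continuous extension as an element of $\mathbb V'$); $\langle\mathcal{C}(\boldsymbol{u}),\boldsymbol{v}\rangle=\int_{\mathcal{O}}|\boldsymbol{u}|^{r-1}\boldsymbol{u}\cdot\boldsymbol{v}\,dx$. An operator $\mathrm{G}:\mathbb{X}\to\mathbb{X}'$ on a Banach space is monotone if $\langle\mathrm{G}(x)-\mathrm{G}(y),x-y\rangle\ge0$ for all $x,y\in\mathbb X$. *)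

theory Defs
  imports "HOL-Analysis.Analysis"
begin

text \<open>
  Elements of the Lebesgue and Sobolev spaces are represented by functions on the whole space, of
  which only the values on \<open>\<Omega>\<close> up to null sets matter. The "norms" below are therefore
  seminorms, vanishing exactly on the functions that are zero almost everywhere on \<open>\<Omega>\<close>.
\<close>

section \<open>Smooth functions and domains with \<open>C\<^sup>2\<close> boundary\<close>

text \<open>For open \<open>S\<close>: all partial derivatives of order at most \<open>k\<close> exist and are continuous on \<open>S\<close>.\<close>

primrec Ck_on :: "nat \<Rightarrow> 'a::euclidean_space set \<Rightarrow> ('a \<Rightarrow> 'b::real_normed_vector) \<Rightarrow> bool" where
  "Ck_on 0 S f \<longleftrightarrow> continuous_on S f"
| "Ck_on (Suc k) S f \<longleftrightarrow>
     (\<forall>x\<in>S. f differentiable (at x)) \<and>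
     (\<forall>e\<in>Basis. Ck_on k S (\<lambda>x. frechet_derivative f (at x) e))"

definition smooth :: "('a::euclidean_space \<Rightarrow> 'b::real_normed_vector) \<Rightarrow> bool" where
  "smooth f \<longleftrightarrow> (\<forall>k. Ck_on k UNIV f)"

text \<open>
  Near each boundary point, \<open>\<Omega>\<close> is the region above the graph of a \<open>C\<^sup>2\<close> function in suitable
  Cartesian coordinates. The unit vector \<open>e\<close> is the vertical axis of these coordinates and
  \<open>x - (x \<bullet> e) *\<^sub>R e\<close> collects the remaining ones; a \<open>C\<^sup>2\<close> function on the hyperplane orthogonal
  to \<open>e\<close> is the same as the restriction of a \<open>C\<^sup>2\<close> function \<open>\<gamma>\<close> on the whole space.
\<close>

definition C2_boundary :: "'a::euclidean_space set \<Rightarrow> bool" where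
  "C2_boundary \<Omega> \<longleftrightarrow>
     (\<forall>x0\<in>frontier \<Omega>. \<exists>\<delta>>0. \<exists>e (\<gamma> :: 'a \<Rightarrow> real).
        norm e = 1 \<and> Ck_on 2 UNIV \<gamma> \<and>
        \<Omega> \<inter> ball x0 \<delta> = {x \<in> ball x0 \<delta>. \<gamma> (x - (x \<bullet> e) *\<^sub>R e) < x \<bullet> e})"

definition bounded_C2_domain :: "'a::euclidean_space set \<Rightarrow> bool" where
  "bounded_C2_domain \<Omega> \<longleftrightarrow>
     open \<Omega> \<and> connected \<Omega> \<and> \<Omega> \<noteq> {} \<and> bounded \<Omega> \<and> C2_boundary \<Omega>"

section \<open>Lebesgue and Sobolev spaces\<close>

definition test_functions ::
  "'a::euclidean_space set \<Rightarrow> ('a \<Rightarrow> 'b::real_normed_vector) set" where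
  "test_functions \<Omega> = {\<phi>. smooth \<phi> \<and> (\<exists>K. compact K \<and> K \<subseteq> \<Omega> \<and> (\<forall>x. x \<notin> K \<longrightarrow> \<phi> x = 0))}"

definition Lp_space ::
  "'a::euclidean_space set \<Rightarrow> real \<Rightarrow> ('a \<Rightarrow> 'b::euclidean_space) set" where
  "Lp_space \<Omega> p = {u. u \<in> borel_measurable (lebesgue_on \<Omega>) \<and>
                       integrable (lebesgue_on \<Omega>) (\<lambda>x. norm (u x) powr p)}"

definition Lp_norm ::
  "'a::euclidean_space set \<Rightarrow> real \<Rightarrow> ('a \<Rightarrow> 'b::euclidean_space) \<Rightarrow> real" where
  "Lp_norm \<Omega> p u = (\<integral>x. norm (u x) powr p \<partial>lebesgue_on \<Omega>) powr (1 / p)"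

definition locally_integrable ::
  "'a::euclidean_space set \<Rightarrow> ('a \<Rightarrow> 'b::euclidean_space) \<Rightarrow> bool" where
  "locally_integrable \<Omega> u \<longleftrightarrow> (\<forall>K. compact K \<and> K \<subseteq> \<Omega> \<longrightarrow> integrable (lebesgue_on K) u)"

text \<open>
  The entry \<open>Du x $ i $ j\<close> is the weak partial derivative of the component \<open>u\<^sub>i\<close> in direction
  \<open>j\<close>. The inner product and norm of \<open>real^'n^'n\<close> are those of Frobenius, so that
  \<open>Du x \<bullet> Dv x\<close> is the contraction of the two gradients.
\<close>

definition weak_gradient ::
  "(real^'n) set \<Rightarrow> (real^'n \<Rightarrow> real^'n) \<Rightarrow> (real^'n \<Rightarrow> real^'n^'n) \<Rightarrow> bool" where
  "weak_gradient \<Omega> u Du \<longleftrightarrow>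
     locally_integrable \<Omega> u \<and> locally_integrable \<Omega> Du \<and>
     (\<forall>(\<psi> :: real^'n \<Rightarrow> real) \<in> test_functions \<Omega>. \<forall>i j.
        (\<integral>x. u x $ i * frechet_derivative \<psi> (at x) (axis j 1) \<partial>lebesgue_on \<Omega>)
          = - (\<integral>x. Du x $ i $ j * \<psi> x \<partial>lebesgue_on \<Omega>))"

text \<open>The weak gradient is unique up to null sets; an arbitrary representative is chosen.\<close>

definition wgrad :: "(real^'n) set \<Rightarrow> (real^'n \<Rightarrow> real^'n) \<Rightarrow> real^'n \<Rightarrow> real^'n^'n" where
  "wgrad \<Omega> u = (SOME Du. weak_gradient \<Omega> u Du)"

definition H1_space :: "(real^'n) set \<Rightarrow> (real^'n \<Rightarrow> real^'n) set" where
  "H1_space \<Omega> = {u \<in> Lp_space \<Omega> 2. \<exists>Du \<in> Lp_space \<Omega> 2. weak_gradient \<Omega> u Du}"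

definition H1_norm :: "(real^'n) set \<Rightarrow> (real^'n \<Rightarrow> real^'n) \<Rightarrow> real" where
  "H1_norm \<Omega> u = sqrt ((Lp_norm \<Omega> 2 u)\<^sup>2 + (Lp_norm \<Omega> 2 (wgrad \<Omega> u))\<^sup>2)"

text \<open>Closure of \<open>S\<close> in the space \<open>E\<close> with norm \<open>N\<close>.\<close>

definition norm_closure ::
  "('a \<Rightarrow> 'b::real_vector) set \<Rightarrow> (('a \<Rightarrow> 'b) \<Rightarrow> real) \<Rightarrow> ('a \<Rightarrow> 'b) set \<Rightarrow> ('a \<Rightarrow> 'b) set" where
  "norm_closure E N S = {u \<in> E. \<forall>\<epsilon>>0. \<exists>\<phi>\<in>S. N (\<lambda>x. u x - \<phi> x) < \<epsilon>}"

definition H10_space :: "(real^'n) set \<Rightarrow> (real^'n \<Rightarrow> real^'n) set" where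
  "H10_space \<Omega> = norm_closure (H1_space \<Omega>) (H1_norm \<Omega>) (test_functions \<Omega>)"

section \<open>Spaces of solenoidal vector fields\<close>

definition divergence :: "(real^'n \<Rightarrow> real^'n) \<Rightarrow> real^'n \<Rightarrow> real" where
  "divergence u x = (\<Sum>i\<in>UNIV. frechet_derivative u (at x) (axis i 1) $ i)"

definition solenoidal_tests :: "(real^'n) set \<Rightarrow> (real^'n \<Rightarrow> real^'n) set" where
  "solenoidal_tests \<Omega> = {\<phi> \<in> test_functions \<Omega>. \<forall>x. divergence \<phi> x = 0}"

definition H_space :: "(real^'n) set \<Rightarrow> (real^'n \<Rightarrow> real^'n) set" where
  "H_space \<Omega> = norm_closure (Lp_space \<Omega> 2) (Lp_norm \<Omega> 2) (solenoidal_tests \<Omega>)"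

definition H_norm :: "(real^'n) set \<Rightarrow> (real^'n \<Rightarrow> real^'n) \<Rightarrow> real" where
  "H_norm \<Omega> u = Lp_norm \<Omega> 2 u"

text \<open>
  The closure is taken in the full \<open>H\<^sup>1\<close> norm, which is equivalent on \<open>H\<^sub>0\<^sup>1\<close> to the norm
  \<open>V_norm\<close> by the Poincare inequality, \<open>\<Omega>\<close> being bounded.
\<close>

definition V_space :: "(real^'n) set \<Rightarrow> (real^'n \<Rightarrow> real^'n) set" where
  "V_space \<Omega> = norm_closure (H10_space \<Omega>) (H1_norm \<Omega>) (solenoidal_tests \<Omega>)"

definition V_norm :: "(real^'n) set \<Rightarrow> (real^'n \<Rightarrow> real^'n) \<Rightarrow> real" where
  "V_norm \<Omega> u = Lp_norm \<Omega> 2 (wgrad \<Omega> u)"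

definition Lsol_space :: "(real^'n) set \<Rightarrow> real \<Rightarrow> (real^'n \<Rightarrow> real^'n) set" where
  "Lsol_space \<Omega> p = norm_closure (Lp_space \<Omega> p) (Lp_norm \<Omega> p) (solenoidal_tests \<Omega>)"

definition VL_space :: "(real^'n) set \<Rightarrow> real \<Rightarrow> (real^'n \<Rightarrow> real^'n) set" where
  "VL_space \<Omega> p = V_space \<Omega> \<inter> Lsol_space \<Omega> p"

definition VL_norm :: "(real^'n) set \<Rightarrow> real \<Rightarrow> (real^'n \<Rightarrow> real^'n) \<Rightarrow> real" where
  "VL_norm \<Omega> p u = max (V_norm \<Omega> u) (Lp_norm \<Omega> p u)"

section \<open>Dual spaces and monotone operators\<close>

text \<open>
  Bounded linear functionals on the function space \<open>X\<close> with norm \<open>N\<close>. Boundedness makes them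
  insensitive to changes on null sets; their values outside \<open>X\<close> are irrelevant. The duality
  pairing of \<open>l\<close> with \<open>w\<close> is the application \<open>l w\<close>.
\<close>

definition dual_space ::
  "('a \<Rightarrow> 'b::real_vector) set \<Rightarrow> (('a \<Rightarrow> 'b) \<Rightarrow> real) \<Rightarrow> (('a \<Rightarrow> 'b) \<Rightarrow> real) set" where
  "dual_space X N = {l.
     (\<forall>u\<in>X. \<forall>v\<in>X. \<forall>a b. l (\<lambda>x. a *\<^sub>R u x + b *\<^sub>R v x) = a * l u + b * l v) \<and>
     (\<exists>C. \<forall>u\<in>X. \<bar>l u\<bar> \<le> C * N u)}"

text \<open>
  The sum of the duals of \<open>V\<close> and of the solenoidal \<open>L\<^sup>p\<close> space, as functionals on the
  intersection of these two spaces.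
\<close>

definition VL_dual_sum ::
  "(real^'n) set \<Rightarrow> real \<Rightarrow> ((real^'n \<Rightarrow> real^'n) \<Rightarrow> real) set" where
  "VL_dual_sum \<Omega> p = {l.
     \<exists>l1 \<in> dual_space (V_space \<Omega>) (V_norm \<Omega>).
     \<exists>l2 \<in> dual_space (Lsol_space \<Omega> p) (Lp_norm \<Omega> p).
       \<forall>w \<in> VL_space \<Omega> p. l w = l1 w + l2 w}"

definition monotone_operator ::
  "('a \<Rightarrow> 'b::real_vector) set \<Rightarrow> (('a \<Rightarrow> 'b) \<Rightarrow> real) \<Rightarrow>
     (('a \<Rightarrow> 'b) \<Rightarrow> ('a \<Rightarrow> 'b) \<Rightarrow> real) \<Rightarrow> bool" where
  "monotone_operator X N G \<longleftrightarrow>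
     (\<forall>u\<in>X. G u \<in> dual_space X N) \<and>
     (\<forall>u\<in>X. \<forall>v\<in>X. G u (\<lambda>x. u x - v x) - G v (\<lambda>x. u x - v x) \<ge> 0)"

section \<open>The operators\<close>

definition A_op ::
  "(real^'n) set \<Rightarrow> (real^'n \<Rightarrow> real^'n) \<Rightarrow> (real^'n \<Rightarrow> real^'n) \<Rightarrow> real" where
  "A_op \<Omega> u v = (\<integral>x. wgrad \<Omega> u x \<bullet> wgrad \<Omega> v x \<partial>lebesgue_on \<Omega>)"

definition trilinear_form ::
  "(real^'n) set \<Rightarrow> (real^'n \<Rightarrow> real^'n) \<Rightarrow> (real^'n \<Rightarrow> real^'n) \<Rightarrow> (real^'n \<Rightarrow> real^'n) \<Rightarrow> real" where
  "trilinear_form \<Omega> u v w = (\<integral>x. (wgrad \<Omega> v x *v u x) \<bullet> w x \<partial>lebesgue_on \<Omega>)"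

text \<open>
  The convective term in the form obtained from \<open>trilinear_form \<Omega> u v w\<close> by integration by parts,
  which needs no integrability of \<open>w\<close> beyond \<open>w \<in> V_space \<Omega>\<close> and so gives a functional on
  that space.
\<close>

definition B_form ::
  "(real^'n) set \<Rightarrow> (real^'n \<Rightarrow> real^'n) \<Rightarrow> (real^'n \<Rightarrow> real^'n) \<Rightarrow> (real^'n \<Rightarrow> real^'n) \<Rightarrow> real" where
  "B_form \<Omega> u v w = - trilinear_form \<Omega> u w v"

definition B_op ::
  "(real^'n) set \<Rightarrow> (real^'n \<Rightarrow> real^'n) \<Rightarrow> (real^'n \<Rightarrow> real^'n) \<Rightarrow> real" where
  "B_op \<Omega> u = B_form \<Omega> u u"

definition C_op ::
  "(real^'n) set \<Rightarrow> real \<Rightarrow> (real^'n \<Rightarrow> real^'n) \<Rightarrow> (real^'n \<Rightarrow> real^'n) \<Rightarrow> real" where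
  "C_op \<Omega> r u v = (\<integral>x. norm (u x) powr (r - 1) * (u x \<bullet> v x) \<partial>lebesgue_on \<Omega>)"

text \<open>The identity, with \<open>H_space \<Omega>\<close> identified with its dual.\<close>

definition Id_op ::
  "(real^'n) set \<Rightarrow> (real^'n \<Rightarrow> real^'n) \<Rightarrow> (real^'n \<Rightarrow> real^'n) \<Rightarrow> real" where
  "Id_op \<Omega> u v = (\<integral>x. u x \<bullet> v x \<partial>lebesgue_on \<Omega>)"

definition G_op ::
  "(real^'n) set \<Rightarrow> real \<Rightarrow> real \<Rightarrow> real \<Rightarrow>
     (real^'n \<Rightarrow> real^'n) \<Rightarrow> (real^'n \<Rightarrow> real^'n) \<Rightarrow> real" where
  "G_op \<Omega> \<mu> \<beta> r u w = \<mu> * A_op \<Omega> u w + B_op \<Omega> u w + \<beta> * C_op \<Omega> r u w"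

end

theory Submission
  imports Defs "HOL-Computational_Algebra.Polynomial"
begin

text \<open>
  With \<open>w = u - v\<close> and \<open>b\<close> the trilinear form, \<open>\<langle>B(u) - B(v), w\<rangle> = - b(w, w, u) - b(v, w, w)\<close>. The
  last term vanishes: for solenoidal test fields \<open>v\<close> and \<open>w\<close> its integrand is a divergence, and the
  general case follows by approximating first \<open>w\<close> in \<open>H\<^sup>1\<close> (with \<open>v\<close> bounded) and then \<open>v\<close> in
  \<open>L\<^sup>p\<close>, \<open>p = r + 1 > 4\<close>, where \<open>\<bar>\<nabla>w\<bar> \<bar>w\<bar>\<close> lies in the dual Lebesgue space. What remains is nonnegative
  pointwise: \<open>\<bar>\<nabla>w\<bar> \<bar>w\<bar> \<bar>u\<bar> \<le> \<mu>/2 \<bar>\<nabla>w\<bar>\<^sup>2 + \<bar>u\<bar>\<^sup>2 \<bar>w\<bar>\<^sup>2 / (2 \<mu>)\<close>, and the last term is absorbed by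
  the monotonicity of \<open>\<beta> C\<close> and \<open>\<rho> \<bar>w\<bar>\<^sup>2\<close> through Young's inequality. All of this rests on weak
  gradients being linear, hence on their uniqueness almost everywhere.
\<close>

section \<open>Smooth test functions\<close>

text \<open>\<open>VL_space\<close> is an intersection of two closures: a field in it has one
  sequence of solenoidal tests converging in H^1 and another converging in L^p, and the definitions
  provide no single sequence doing both. Hence b(v, w, w) = 0 is not obtained by density in the norm
  of the intersection. Each of the two passages moves one argument in the one norm available for it:
  a bounded v makes L^2 control of w and its gradient sufficient, and with w fixed only L^p control
  of v is needed. The second passage is where p \<ge> 4 enters, through 1/2 + 2/p \<le> 1.

  The other obstacle is that \<open>wgrad\<close> is an arbitrary choice: what it selects for u - v
  has no a priori relation to what it selects for u and v, and even its square integrability has to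
  be transferred from another weak gradient by uniqueness. Uniqueness is the fundamental lemma of
  the calculus of variations. Instead of convolution, its proof uses explicit bumps converging to
  indicators of boxes, and a Dynkin argument passes from boxes to all Borel sets.\<close>

lemma Ck_on_SucD:
  assumes "Ck_on (Suc k) UNIV f"
  shows "Ck_on k UNIV f"
  using assms
proof (induction k arbitrary: f)
  case 0
  then show ?case
    by (auto intro!: continuous_at_imp_continuous_on differentiable_imp_continuous_within)
next
  case (Suc k)
  then show ?case by (metis Ck_on.simps(2))
qed

lemma frechet_derivative_lincomb:
  assumes "f differentiable (at x)" and "g differentiable (at x)"
  shows "frechet_derivative (\<lambda>x. a *\<^sub>R f x + b *\<^sub>R g x) (at x)
    = (\<lambda>e. a *\<^sub>R frechet_derivative f (at x) e + b *\<^sub>R frechet_derivative g (at x) e)"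
proof -
  have "(f has_derivative frechet_derivative f (at x)) (at x)"
    and "(g has_derivative frechet_derivative g (at x)) (at x)"
    using assms by (simp_all flip: frechet_derivative_works)
  then show ?thesis
    by (intro frechet_derivative_at[symmetric] derivative_intros)
qed

lemma Ck_on_lincomb:
  assumes "Ck_on k UNIV f" and "Ck_on k UNIV g"
  shows "Ck_on k UNIV (\<lambda>x. a *\<^sub>R f x + b *\<^sub>R g x)"
  using assms
proof (induction k arbitrary: f g)
  case 0
  then show ?case by (auto intro!: continuous_intros)
next
  case (Suc k)
  then show ?case
    by (simp add: frechet_derivative_lincomb differentiable_add differentiable_scaleR)
qed

lemma frechet_derivative_times:
  fixes f g :: "'a::real_normed_vector \<Rightarrow> real"
  assumes "f differentiable (at x)" and "g differentiable (at x)"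
  shows "frechet_derivative (\<lambda>x. f x * g x) (at x)
    = (\<lambda>e. f x * frechet_derivative g (at x) e + frechet_derivative f (at x) e * g x)"
proof -
  have "(f has_derivative frechet_derivative f (at x)) (at x)"
    and "(g has_derivative frechet_derivative g (at x)) (at x)"
    using assms by (simp_all flip: frechet_derivative_works)
  then show ?thesis
    by (intro frechet_derivative_at[symmetric] derivative_intros)
qed

lemma Ck_on_times:
  fixes f g :: "'a::euclidean_space \<Rightarrow> real"
  assumes "Ck_on k UNIV f" and "Ck_on k UNIV g"
  shows "Ck_on k UNIV (\<lambda>x. f x * g x)"
  using assms
proof (induction k arbitrary: f g)
  case 0
  then show ?case by (auto intro!: continuous_intros)
next
  case (Suc k)
  have "Ck_on k UNIV (\<lambda>x. frechet_derivative (\<lambda>x. f x * g x) (at x) e)" if e: "e \<in> Basis" for e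
  proof -
    \<comment> \<open>The product rule leaves one factor undifferentiated; it is lowered from order
      \<open>Suc k\<close> to order \<open>k\<close> so that the induction hypothesis covers both
      summands.\<close>
    have "Ck_on k UNIV (\<lambda>x. f x * frechet_derivative g (at x) e)"
      and "Ck_on k UNIV (\<lambda>x. frechet_derivative f (at x) e * g x)"
      using Suc.prems e Suc.prems[THEN Ck_on_SucD] by (simp_all add: Suc.IH)
    from Ck_on_lincomb[OF this, of 1 1] show ?thesis
      using Suc.prems by (simp add: frechet_derivative_times)
  qed
  then show ?case
    using Suc.prems by (simp add: differentiable_mult)
qed

lemma Ck_on_const: "Ck_on k UNIV (\<lambda>x. c)"
  by (induction k arbitrary: c) auto

lemma Ck_on_prod:
  fixes f :: "'i \<Rightarrow> 'a::euclidean_space \<Rightarrow> real"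
  assumes "\<And>i. i \<in> I \<Longrightarrow> Ck_on k UNIV (f i)"
  shows "Ck_on k UNIV (\<lambda>x. \<Prod>i\<in>I. f i x)"
  using assms by (induction I rule: infinite_finite_induct) (auto intro: Ck_on_const Ck_on_times)

text \<open>The functions \<open>P(1/t) exp(-1/t)\<close> on the positive half line, extended by zero, are closed
  under differentiation.\<close>

definition flat :: "real poly \<Rightarrow> real \<Rightarrow> real" where
  "flat P t = (if t > 0 then poly P (1 / t) * exp (- (1 / t)) else 0)"

lemma poly_exp_tendsto_0: "((\<lambda>y. poly P y * exp (- y)) \<longlongrightarrow> (0::real)) at_top"
proof -
  have "((\<lambda>y. \<Sum>i\<le>degree P. coeff P i * (y ^ i / exp y)) \<longlongrightarrow> (\<Sum>i\<le>degree P. coeff P i * 0)) at_top"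
    by (intro tendsto_intros tendsto_power_div_exp_0)
  then show ?thesis
    by (simp add: poly_altdef exp_minus sum_divide_distrib divide_inverse sum_distrib_right mult.assoc)
qed

lemma flat_tendsto_0: "(flat P \<longlongrightarrow> 0) (at 0)"
proof (rule filterlim_split_at)
  have "\<forall>\<^sub>F t in at_left 0. flat P t = 0"
    by (auto simp: flat_def eventually_at_filter)
  then show "(flat P \<longlongrightarrow> 0) (at_left 0)"
    by (simp add: tendsto_eventually)
  have "((\<lambda>t. poly P (inverse t) * exp (- inverse t)) \<longlongrightarrow> 0) (at_right 0)"
    by (rule filterlim_compose[OF poly_exp_tendsto_0 filterlim_inverse_at_top_right])
  then show "(flat P \<longlongrightarrow> 0) (at_right 0)"
    by (rule Lim_transform_eventually) (auto simp: flat_def eventually_at_filter inverse_eq_divide)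
qed

text \<open>The inner derivative of 1/t is -1/t^2, so differentiating P(1/t) exp(-1/t) produces
  (1/t)^2 (P - P')(1/t) exp(-1/t). The factor (1/t)^2 is the polynomial \<open>[:0, 0, 1:]\<close>.
  The one delicate point is t = 0.\<close>

lemma flat_has_derivative:
  "(flat P has_real_derivative flat ([:0, 0, 1:] * (P - pderiv P)) t) (at t)"
proof (cases t "0::real" rule: linorder_cases)
  case less
  have "((\<lambda>_. 0) has_real_derivative 0) (at t)" by simp
  then have "(flat P has_real_derivative 0) (at t)"
    by (rule has_field_derivative_transform_within_open[where S="{..<0}"])
       (use less in \<open>auto simp: flat_def\<close>)
  then show ?thesis using less by (simp add: flat_def)
next
  case equal
  \<comment> \<open>The difference quotient at 0 is P(1/h) exp(-1/h) / h for h > 0, again a flat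
    function, with P multiplied by the variable; hence it tends to 0.\<close>
  have "((\<lambda>h. flat ([:0, 1:] * P) h) \<longlongrightarrow> 0) (at 0)"
    by (rule flat_tendsto_0)
  then have "((\<lambda>h. (flat P (0 + h) - flat P 0) / h) \<longlongrightarrow> 0) (at 0)"
    by (rule Lim_transform_eventually) (auto simp: flat_def eventually_at_filter)
  then show ?thesis
    using equal by (simp add: DERIV_def flat_def)
next
  case greater
  have "((\<lambda>t. poly P (1 / t) * exp (- (1 / t))) has_real_derivative
      poly ([:0, 0, 1:] * (P - pderiv P)) (1 / t) * exp (- (1 / t))) (at t)"
    by (rule derivative_eq_intros DERIV_chain2[OF poly_DERIV] refl | use greater in force)+
       (use greater in \<open>simp add: field_simps power2_eq_square\<close>)
  then have "(flat P has_real_derivative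
      poly ([:0, 0, 1:] * (P - pderiv P)) (1 / t) * exp (- (1 / t))) (at t)"
    by (rule has_field_derivative_transform_within_open[where S="{0<..}"])
       (use greater in \<open>auto simp: flat_def\<close>)
  then show ?thesis using greater by (simp add: flat_def)
qed

text \<open>The family is kept general in P so that the induction closes: each partial derivative is
  a constant multiple of a member of the same family, with the polynomial from
  \<open>flat_has_derivative\<close>.\<close>

lemma Ck_on_flat:
  fixes e :: "'a::euclidean_space"
  shows "Ck_on k UNIV (\<lambda>x. flat P (x \<bullet> e + c))"
proof (induction k arbitrary: P)
  case 0
  have "continuous_on UNIV (flat P)"
    by (meson DERIV_isCont continuous_at_imp_continuous_on flat_has_derivative)
  then show ?case
    by (auto intro!: continuous_on_compose2[of UNIV "flat P"] continuous_intros)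
next
  case (Suc k)
  let ?Q = "[:0, 0, 1:] * (P - pderiv P)"
  have D: "((\<lambda>x. flat P (x \<bullet> e + c)) has_derivative (\<lambda>b. flat ?Q (x \<bullet> e + c) * (b \<bullet> e))) (at x)" for x
  proof -
    have "((\<lambda>x. x \<bullet> e + c) has_derivative (\<lambda>b. b \<bullet> e)) (at x)"
      by (auto intro!: derivative_eq_intros)
    from has_derivative_compose[OF this flat_has_derivative[unfolded has_field_derivative_def, of P]]
    show ?thesis by simp
  qed
  have "Ck_on k UNIV (\<lambda>x. frechet_derivative (\<lambda>x. flat P (x \<bullet> e + c)) (at x) b)" for b
    \<comment> \<open>The coefficient 0 turns closure under linear combinations into closure under
      scalar multiples.\<close>
    using Ck_on_lincomb[OF Suc.IH[of ?Q] Suc.IH[of ?Q], of "b \<bullet> e" 0]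
    by (simp add: frechet_derivative_at[OF D, symmetric] mult.commute)
  then show ?case
    using D by (auto simp: differentiable_def)
qed

text \<open>For k \<ge> 1 and s > 0 the factor \<open>flat 1 (k * s)\<close> is exp(-1/(k s)), which
  tends to 1 as k grows. The parameter k thus steepens the edges while the support stays in one
  fixed box, and the bumps approximate the indicator of the open box pointwise with values in
  [0, 1].\<close>

definition box_bump :: "'a::euclidean_space \<Rightarrow> 'a \<Rightarrow> nat \<Rightarrow> 'a \<Rightarrow> real" where
  "box_bump a b k x = (\<Prod>i\<in>Basis. flat 1 (real k * ((x - a) \<bullet> i)) * flat 1 (real k * ((b - x) \<bullet> i)))"

lemma flat_1_bounds: "0 \<le> flat 1 t" "flat 1 t \<le> 1"
  by (auto simp: flat_def)

lemma box_bump_bounds: "0 \<le> box_bump a b k x" "box_bump a b k x \<le> 1"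
  unfolding box_bump_def
  by (auto intro!: prod_nonneg prod_le_1 mult_nonneg_nonneg mult_le_one simp: flat_1_bounds)

lemma box_bump_eq_0: "x \<notin> box a b \<Longrightarrow> box_bump a b k x = 0"
proof -
  assume "x \<notin> box a b"
  then obtain i where "i \<in> Basis" "x \<bullet> i \<le> a \<bullet> i \<or> b \<bullet> i \<le> x \<bullet> i"
    by (auto simp: box_def not_less)
  then show ?thesis
    unfolding box_bump_def
    by (intro prod_zero bexI[of _ i]) (auto simp: flat_def inner_diff_left zero_less_mult_iff)
qed

lemma smooth_box_bump: "smooth (box_bump a b k)"
  unfolding smooth_def
proof
  fix m
  have "Ck_on m UNIV (\<lambda>x. flat 1 (x \<bullet> (real k *\<^sub>R i) + (- real k * (a \<bullet> i))) *
      flat 1 (x \<bullet> (- real k *\<^sub>R i) + real k * (b \<bullet> i)))" for i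
    by (intro Ck_on_times Ck_on_flat)
  then have "Ck_on m UNIV (\<lambda>x. \<Prod>i\<in>Basis. flat 1 (x \<bullet> (real k *\<^sub>R i) + (- real k * (a \<bullet> i))) *
      flat 1 (x \<bullet> (- real k *\<^sub>R i) + real k * (b \<bullet> i)))"
    by (rule Ck_on_prod)
  then show "Ck_on m UNIV (box_bump a b k)"
    by (simp add: box_bump_def[abs_def] inner_diff_left right_diff_distrib)
qed

lemma box_bump_tendsto:
  "(\<lambda>k. box_bump a b k x) \<longlonglongrightarrow> indicator (box a b) x"
proof (cases "x \<in> box a b")
  case True
  have lim: "(\<lambda>k. flat 1 (real k * s)) \<longlonglongrightarrow> 1" if "s > 0" for s
  proof -
    have "(\<lambda>k. exp (- (inverse (real k) * inverse s))) \<longlonglongrightarrow> exp (- (0 * inverse s))"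
      by (intro tendsto_intros lim_inverse_n)
    then have "(\<lambda>k. exp (- (inverse (real k) * inverse s))) \<longlonglongrightarrow> 1" by simp
    then show ?thesis
    proof (rule Lim_transform_eventually)
      show "\<forall>\<^sub>F k in sequentially. exp (- (inverse (real k) * inverse s)) = flat 1 (real k * s)"
        using eventually_gt_at_top[of "0::nat"]
        by eventually_elim (use that in \<open>simp add: flat_def divide_simps\<close>)
    qed
  qed
  have "(\<lambda>k. box_bump a b k x) \<longlonglongrightarrow> (\<Prod>i\<in>(Basis::'a set). 1 * 1)"
    unfolding box_bump_def
    by (intro tendsto_intros lim) (use True in \<open>auto simp: box_def inner_diff_left\<close>)
  then show ?thesis using True by simp
qed (simp add: box_bump_eq_0)

lemma box_bump_test_function:
  assumes "cbox a b \<subseteq> \<Omega>"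
  shows "box_bump a b k \<in> test_functions \<Omega>"
  using assms smooth_box_bump[of a b k] box_bump_eq_0[of _ a b k] box_subset_cbox[of a b]
  unfolding test_functions_def by (blast intro: compact_cbox)

section \<open>The fundamental lemma of the calculus of variations\<close>

text \<open>Testing with bumps and letting them converge to the indicator of a box shows that f has
  integral 0 over every box inside \<open>box c d\<close>. Boxes are stable under intersection and
  generate the Borel sets, so the integral over every Borel set vanishes, which forces the function
  to be 0 almost everywhere.\<close>

lemma test_function_orthogonal_imp_AE_zero_cbox:
  fixes f :: "'a::euclidean_space \<Rightarrow> real"
  assumes meas: "\<Omega> \<in> sets lebesgue" and cd: "cbox c d \<subseteq> \<Omega>"
    and f: "integrable (lebesgue_on (cbox c d)) f"
    and orth: "\<And>\<psi>. \<psi> \<in> test_functions \<Omega> \<Longrightarrow> (\<integral>x. f x * \<psi> x \<partial>lebesgue_on \<Omega>) = 0"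
  shows "AE x in lebesgue. x \<in> box c d \<longrightarrow> f x = 0"
proof -
  define h where "h x = indicator (box c d) x * f x" for x
  have "integrable lebesgue (\<lambda>x. indicator (cbox c d) x * f x)"
    using f by (simp add: integrable_restrict_space)
  then have "integrable lebesgue (\<lambda>x. indicator (box c d) x *\<^sub>R (indicator (cbox c d) x * f x))"
    by (rule integrable_mult_indicator[rotated]) auto
  also have "(\<lambda>x. indicator (box c d) x *\<^sub>R (indicator (cbox c d) x * f x)) = h"
    using box_subset_cbox[of c d] by (auto simp: h_def indicator_def fun_eq_iff)
  finally have h: "integrable lebesgue h" .
  \<comment> \<open>A Borel representative is needed because the Dynkin argument runs over the Borel
    sets generated by boxes, whereas \<open>h\<close> is only Lebesgue measurable.\<close>
  obtain g where g[measurable]: "g \<in> borel_measurable lborel" and hg: "AE x in lborel. h x = g x"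
    using completion_ex_borel_measurable_real[of h lborel] h by blast
  have hg': "AE x in lebesgue. h x = g x"
    using hg by (rule AE_completion)
  have g_leb: "integrable lebesgue g"
    by (rule integrable_cong_AE_imp[OF h _ hg']) (auto intro: measurable_completion)
  have gi: "integrable lborel g"
    using g_leb g by (simp add: integrable_completion)
  have zero: "(\<integral>x. indicator (box a b) x * g x \<partial>lborel) = 0" for a b
  proof -
    \<comment> \<open>Since \<open>h\<close> vanishes off \<open>box c d\<close>, an arbitrary box
      may be cut down to one inside it, whose bumps are test functions on \<Omega>.\<close>
    obtain a' b' where ab': "box a b \<inter> box c d = box a' b'"
      using that[OF box_Int_box] .
    have lim: "(\<lambda>k. \<integral>x. h x * box_bump a' b' k x \<partial>lebesgue) \<longlonglongrightarrow> (\<integral>x. h x * indicator (box a' b') x \<partial>lebesgue)"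
    proof (rule integral_dominated_convergence[where w="\<lambda>x. \<bar>h x\<bar>"])
      have "continuous_on UNIV (box_bump a' b' k)" for k
        using smooth_box_bump[of a' b' k] unfolding smooth_def by (metis Ck_on.simps(1))
      then have "box_bump a' b' k \<in> borel_measurable lebesgue" for k
        by (intro measurable_completion) (auto intro: borel_measurable_continuous_onI)
      then show "(\<lambda>x. h x * box_bump a' b' k x) \<in> borel_measurable lebesgue" for k
        using h by (intro borel_measurable_times) auto
      show "(\<lambda>x. h x * indicator (box a' b') x) \<in> borel_measurable lebesgue"
        using h by (intro borel_measurable_times borel_measurable_indicator) auto
      show "integrable lebesgue (\<lambda>x. \<bar>h x\<bar>)" using h by simp
      show "AE x in lebesgue. (\<lambda>k. h x * box_bump a' b' k x) \<longlonglongrightarrow> h x * indicator (box a' b') x"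
        by (intro AE_I2 tendsto_intros box_bump_tendsto)
      show "AE x in lebesgue. norm (h x * box_bump a' b' k x) \<le> \<bar>h x\<bar>" for k
        by (auto simp: abs_mult box_bump_bounds intro!: mult_left_le)
    qed
    have "(\<integral>x. h x * box_bump a' b' k x \<partial>lebesgue) = 0" for k
    proof (cases "box a' b' = {}")
      case True
      then show ?thesis by (simp add: box_bump_eq_0)
    next
      case False
      have "box a' b' \<subseteq> box c d" using ab' by blast
      then have "cbox a' b' \<subseteq> cbox c d"
        using False by (metis box_subset_cbox closure_box closure_minimal closed_cbox order_trans)
      then have "box_bump a' b' k \<in> test_functions \<Omega>"
        using cd by (intro box_bump_test_function) auto
      then have "0 = (\<integral>x. f x * box_bump a' b' k x \<partial>lebesgue_on \<Omega>)"
        using orth by simp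
      also have "\<dots> = (\<integral>x. indicator \<Omega> x * (f x * box_bump a' b' k x) \<partial>lebesgue)"
        using meas by (simp add: integral_restrict_space)
      also have "\<dots> = (\<integral>x. h x * box_bump a' b' k x \<partial>lebesgue)"
      proof (rule Bochner_Integration.integral_cong)
        fix x
        show "indicator \<Omega> x * (f x * box_bump a' b' k x) = h x * box_bump a' b' k x"
        proof (cases "x \<in> box a' b'")
          case True
          then have "x \<in> box c d" "x \<in> \<Omega>"
            using ab' cd box_subset_cbox[of c d] by auto
          then show ?thesis by (simp add: h_def)
        qed (simp add: box_bump_eq_0)
      qed simp
      finally show ?thesis ..
    qed
    then have "(\<integral>x. h x * indicator (box a' b') x \<partial>lebesgue) = 0"
      using lim LIMSEQ_unique[OF _ tendsto_const] by (simp add: LIMSEQ_const_iff)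
    moreover have "h x * indicator (box a' b') x = indicator (box a b) x * h x" for x
      by (auto simp: h_def ab'[symmetric] indicator_def)
    ultimately have "0 = (\<integral>x. indicator (box a b) x * h x \<partial>lebesgue)"
      by simp
    also have "\<dots> = (\<integral>x. indicator (box a b) x * g x \<partial>lebesgue)"
      using hg' h
      by (intro integral_cong_AE borel_measurable_times borel_measurable_indicator)
        (auto intro: measurable_completion)
    also have "\<dots> = (\<integral>x. indicator (box a b) x * g x \<partial>lborel)"
      by (rule integral_completion) auto
    finally show ?thesis ..
  qed
  \<comment> \<open>The integral over the whole space is what the complement case of the Dynkin
    induction subtracts from.\<close>
  have total: "(\<integral>x. g x \<partial>lborel) = 0"
  proof -
    have "AE x in lborel. g x = indicator (box c d) x * g x"
      using hg by eventually_elim (auto simp: h_def indicator_def)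
    then have "(\<integral>x. g x \<partial>lborel) = (\<integral>x. indicator (box c d) x * g x \<partial>lborel)"
      by (intro integral_cong_AE) auto
    then show ?thesis using zero by simp
  qed
  have si: "set_integrable lborel B g" if "B \<in> sets lborel" for B
    unfolding set_integrable_def by (rule integrable_mult_indicator[OF that gi])
  have "set_lebesgue_integral lborel A g = 0" if A: "A \<in> sets lborel" for A
  proof -
    have "Int_stable (range (\<lambda>(a, b). box a b :: 'a set))"
      by (auto simp: Int_stable_def box_Int_box)
    moreover have "range (\<lambda>(a, b). box a b :: 'a set) \<subseteq> Pow UNIV"
      by auto
    moreover have "A \<in> sigma_sets UNIV (range (\<lambda>(a, b). box a b))"
      using A by (simp add: borel_eq_box)
    ultimately show ?thesis
    proof (induction rule: sigma_sets_induct_disjoint)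
      case (basic A)
      then show ?case using zero by (auto simp: set_lebesgue_integral_def)
    next
      case empty
      then show ?case by (simp add: set_lebesgue_integral_def)
    next
      case (compl A)
      then have A: "A \<in> sets lborel" by (simp add: borel_eq_box)
      then have "set_integrable lborel A g" "set_integrable lborel (UNIV - A) g"
        by (auto intro!: si)
      then have "set_lebesgue_integral lborel (A \<union> (UNIV - A)) g =
          set_lebesgue_integral lborel A g + set_lebesgue_integral lborel (UNIV - A) g"
        by (intro set_integral_Un) auto
      then show ?case
        using total compl by (simp add: set_lebesgue_integral_def)
    next
      case (union A)
      then have A: "\<And>i. A i \<in> sets lborel" by (auto simp: borel_eq_box)
      then have "set_integrable lborel (\<Union>i. A i) g"
        by (auto intro!: si)
      then have "set_lebesgue_integral lborel (\<Union>i. A i) g = (\<Sum>i. set_lebesgue_integral lborel (A i) g)"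
        using A union(1) by (intro lebesgue_integral_countable_add) (auto simp: disjoint_family_on_def)
      then show ?case using union by simp
    qed
  qed
  then have "AE x in lborel. g x = 0"
    using gi by (intro sigma_finite_measure.density_zero[OF sigma_finite_lborel])
  then have "AE x in lebesgue. g x = 0"
    by (rule AE_completion)
  with hg' show ?thesis
    by eventually_elim (auto simp: h_def)
qed

text \<open>An open set is a countable union of closed boxes. Each box contributes one null set in
  its interior, and its boundary is negligible; countably many null sets remain null.\<close>

lemma fundamental_lemma_calculus_of_variations:
  fixes f :: "'a::euclidean_space \<Rightarrow> real"
  assumes "open \<Omega>"
    and f: "locally_integrable \<Omega> f"
    and orth: "\<And>\<psi>. \<psi> \<in> test_functions \<Omega> \<Longrightarrow> (\<integral>x. f x * \<psi> x \<partial>lebesgue_on \<Omega>) = 0"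
  shows "AE x in lebesgue_on \<Omega>. f x = 0"
proof -
  obtain \<D> where D: "countable \<D>" "\<Union>\<D> = \<Omega>" "\<And>X. X \<in> \<D> \<Longrightarrow> \<exists>a b. X = cbox a b"
    using open_countable_Union_open_cbox[OF \<open>open \<Omega>\<close>] by metis
  have "AE x in lebesgue. x \<in> X \<longrightarrow> f x = 0" if X: "X \<in> \<D>" for X
  proof -
    obtain a b where ab: "X = cbox a b" using D(3) X by blast
    have "integrable (lebesgue_on X) f"
      using f X ab D(2) unfolding locally_integrable_def by (metis Union_upper compact_cbox)
    then have "AE x in lebesgue. x \<in> box a b \<longrightarrow> f x = 0"
      using orth ab X D(2) \<open>open \<Omega>\<close>
      by (intro test_function_orthogonal_imp_AE_zero_cbox[of \<Omega>]) auto
    moreover have "AE x in lebesgue. x \<notin> cbox a b - box a b"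
      using negligible_frontier_interval[of a b]
      by (intro AE_not_in) (simp add: negligible_iff_null_sets)
    ultimately show ?thesis
      by eventually_elim (auto simp: ab)
  qed
  then have "AE x in lebesgue. \<forall>X\<in>\<D>. x \<in> X \<longrightarrow> f x = 0"
    using D(1) by (subst AE_ball_countable) auto
  then have "AE x in lebesgue. x \<in> \<Omega> \<longrightarrow> f x = 0"
    by eventually_elim (use D(2) in auto)
  then show ?thesis
    using \<open>open \<Omega>\<close> by (simp add: AE_restrict_space_iff)
qed

section \<open>Integrals of derivatives of compactly supported functions\<close>

lemma frechet_derivative_outside_support:
  assumes "closed K" and supp: "\<And>x. x \<notin> K \<Longrightarrow> F x = 0" and "x \<notin> K"
  shows "frechet_derivative F (at x) = (\<lambda>_. 0)"
proof -
  have "open (- K)" using \<open>closed K\<close> by (simp add: open_Compl)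
  have "((\<lambda>_. 0) has_derivative (\<lambda>_. 0)) (at x)" by simp
  then have "(F has_derivative (\<lambda>_. 0)) (at x)"
    by (rule has_derivative_transform_within_open[OF _ \<open>open (- K)\<close>]) (use assms in auto)
  then show ?thesis by (simp flip: frechet_derivative_at)
qed

lemma integrable_continuous_compact_support:
  fixes g :: "'a::euclidean_space \<Rightarrow> real"
  assumes cont: "continuous_on UNIV g" and "compact K" and supp: "\<And>x. x \<notin> K \<Longrightarrow> g x = 0"
  shows "integrable lborel g"
proof -
  have "integrable lborel (\<lambda>x. indicator K x *\<^sub>R g x)"
    by (rule borel_integrable_compact[OF \<open>compact K\<close> continuous_on_subset[OF cont]]) simp
  then show ?thesis
    by (rule Bochner_Integration.integrable_cong[THEN iffD1, rotated 2]) (auto simp: supp indicator_def)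
qed

text \<open>Translation invariance of Lebesgue measure gives every difference quotient integral 0,
  and dominated convergence passes to the derivative. This replaces Fubini and the one-dimensional
  fundamental theorem, and treats all directions alike.\<close>

lemma integral_directional_derivative_eq_0:
  fixes F :: "'a::euclidean_space \<Rightarrow> real"
  assumes diff: "\<And>x. F differentiable (at x)"
    and cont: "continuous_on UNIV (\<lambda>x. frechet_derivative F (at x) e)"
    and K: "compact K" and supp: "\<And>x. x \<notin> K \<Longrightarrow> F x = 0"
  shows "(\<integral>x. frechet_derivative F (at x) e \<partial>lborel) = 0"
proof -
  define D where "D x = frechet_derivative F (at x) e" for x
  define q where "q n x = real (Suc n) * (F (x + (1 / real (Suc n)) *\<^sub>R e) - F x)" for n x
  have contF: "continuous_on UNIV F"
    by (simp add: continuous_at_imp_continuous_on diff differentiable_imp_continuous_within)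
  have line: "((\<lambda>s. F (x + s *\<^sub>R e)) has_real_derivative D (x + s *\<^sub>R e)) (at s)" for x s
  proof -
    have "((\<lambda>s. x + s *\<^sub>R e) has_derivative (\<lambda>h. h *\<^sub>R e)) (at s)"
      by (auto intro!: derivative_eq_intros)
    moreover have *: "(F has_derivative frechet_derivative F (at (x + s *\<^sub>R e))) (at (x + s *\<^sub>R e))"
      using diff by (simp flip: frechet_derivative_works)
    ultimately have "((\<lambda>s. F (x + s *\<^sub>R e)) has_derivative
        (\<lambda>h. frechet_derivative F (at (x + s *\<^sub>R e)) (h *\<^sub>R e))) (at s)"
      by (rule has_derivative_compose)
    moreover have "frechet_derivative F (at (x + s *\<^sub>R e)) (h *\<^sub>R e) = D (x + s *\<^sub>R e) * h" for h
      using linear_scale[OF has_derivative_linear[OF *]] by (simp add: D_def)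
    ultimately show ?thesis
      by (simp add: has_field_derivative_def)
  qed
  have D0: "D x = 0" if "x \<notin> K" for x
    using frechet_derivative_outside_support[of K F x] K supp that
    by (simp add: D_def compact_imp_closed)
  obtain M where M: "\<And>x. \<bar>D x\<bar> \<le> M"
  proof -
    have "continuous_on K D"
      using cont unfolding D_def[symmetric] by (rule continuous_on_subset) simp
    then have "bounded (D ` K)"
      using K compact_continuous_image compact_imp_bounded by blast
    then obtain M where "\<forall>x\<in>K. \<bar>D x\<bar> \<le> M"
      by (auto simp: bounded_iff)
    then have "\<bar>D x\<bar> \<le> max M 0" for x
      using D0[of x] by (cases "x \<in> K") auto
    then show ?thesis using that by blast
  qed
  obtain R where R: "\<And>x. x \<in> K \<Longrightarrow> norm x \<le> R"
    using K compact_imp_bounded bounded_iff by metis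
  \<comment> \<open>The steps 1 / (n + 1) are at most 1, so a shift moves a point by at most the
    norm of \<open>e\<close>; outside this enlarged ball both values of \<open>F\<close> in
    \<open>q n x\<close> vanish, for all n at once.\<close>
  define B where "B = cball (0::'a) (R + norm e)"
  have F0: "F x = 0" if "norm x > R" for x
    using that R supp by force
  have bound: "\<bar>q n x\<bar> \<le> indicator B x * M" for n x
  proof (cases "x \<in> B")
    case True
    \<comment> \<open>The mean value theorem along the segment turns the quotient into a value of
      the derivative, so the bound \<open>M\<close> for \<open>D\<close> dominates all
      quotients.\<close>
    obtain s where s: "F (x + (1 / real (Suc n)) *\<^sub>R e) - F (x + 0 *\<^sub>R e) = (1 / real (Suc n) - 0) * D (x + s *\<^sub>R e)"
      using MVT2[of 0 "1 / real (Suc n)" "\<lambda>s. F (x + s *\<^sub>R e)" "\<lambda>s. D (x + s *\<^sub>R e)"] line by auto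
    then have "q n x = D (x + s *\<^sub>R e)"
      by (simp add: q_def del: of_nat_Suc)
    then show ?thesis using M True by simp
  next
    case False
    then have x: "norm x > R + norm e" by (simp add: B_def)
    have "norm ((1 / real (Suc n)) *\<^sub>R e) \<le> norm e"
      by (simp add: divide_simps mult_le_cancel_right1 del: of_nat_Suc) (simp add: algebra_simps)
    then have "norm (x + (1 / real (Suc n)) *\<^sub>R e) > R"
      using x norm_diff_ineq[of x "(1 / real (Suc n)) *\<^sub>R e"] by linarith
    moreover have "norm x > R"
      using x by (smt (verit) norm_ge_zero)
    ultimately show ?thesis
      using False by (simp add: q_def F0 del: of_nat_Suc)
  qed
  have Fm[measurable]: "F \<in> borel_measurable borel"
    using contF by (rule borel_measurable_continuous_onI)
  have Dm[measurable]: "D \<in> borel_measurable borel"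
    using cont unfolding D_def[symmetric] by (rule borel_measurable_continuous_onI)
  have Fi: "integrable lborel F"
    by (rule integrable_continuous_compact_support[OF contF K supp])
  have "(\<integral>x. q n x \<partial>lborel) = 0" for n
  proof -
    define c where "c = (1 / real (Suc n)) *\<^sub>R e"
    have "integral\<^sup>L lborel F = integral\<^sup>L (distr lborel borel ((+) c)) F"
      by (simp add: lborel_distr_plus)
    also have "\<dots> = (\<integral>x. F (x + c) \<partial>lborel)"
      by (subst integral_distr) (auto simp: add.commute)
    finally have eq: "integral\<^sup>L lborel F = (\<integral>x. F (x + c) \<partial>lborel)" .
    have "integrable (distr lborel borel ((+) c)) F"
      using Fi by (simp add: lborel_distr_plus)
    then have "integrable lborel (\<lambda>x. F (x + c))"
      by (subst (asm) integrable_distr_eq) (auto simp: add.commute)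
    then show ?thesis
      using Fi eq unfolding q_def c_def[symmetric] by simp
  qed
  moreover have "(\<lambda>n. \<integral>x. q n x \<partial>lborel) \<longlonglongrightarrow> (\<integral>x. D x \<partial>lborel)"
  proof (rule integral_dominated_convergence[where w="\<lambda>x. indicator B x * M"])
    show "integrable lborel (\<lambda>x. indicator B x * M)"
      using borel_integrable_compact[of B "\<lambda>_. M"] by (simp add: B_def)
    show "AE x in lborel. norm (q n x) \<le> indicator B x * M" for n
      using bound by simp
    show "AE x in lborel. (\<lambda>n. q n x) \<longlonglongrightarrow> D x"
    proof (rule AE_I2)
      fix x
      have "((\<lambda>h. (F (x + h *\<^sub>R e) - F x) / h) \<longlongrightarrow> D x) (at 0)"
        using line[of x 0] by (simp add: DERIV_def)
      moreover have "filterlim (\<lambda>n. 1 / real (Suc n)) (at 0) sequentially"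
        using LIMSEQ_inverse_real_of_nat
        by (auto simp: filterlim_at inverse_eq_divide intro!: always_eventually simp del: of_nat_Suc)
      ultimately have "(\<lambda>n. (F (x + (1 / real (Suc n)) *\<^sub>R e) - F x) / (1 / real (Suc n))) \<longlonglongrightarrow> D x"
        by (rule filterlim_compose)
      then show "(\<lambda>n. q n x) \<longlonglongrightarrow> D x"
        by (simp add: q_def mult.commute del: of_nat_Suc)
    qed
  qed (auto simp: q_def)
  ultimately show ?thesis
    by (simp add: D_def LIMSEQ_const_iff)
qed

section \<open>Lebesgue spaces\<close>

text \<open>Young's inequality applied pointwise gives integrability; applied to f and g divided by
  their norms it gives the bound. The normalisation fails when a norm is 0, but then the product
  vanishes almost everywhere.\<close>

lemma Holder_inequality:
  fixes f g :: "'a \<Rightarrow> real"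
  assumes pq: "p > 1" "q > 1" "1 / p + 1 / q = 1"
    and [measurable]: "f \<in> borel_measurable M" "g \<in> borel_measurable M"
    and fp: "integrable M (\<lambda>x. \<bar>f x\<bar> powr p)" and gq: "integrable M (\<lambda>x. \<bar>g x\<bar> powr q)"
  shows "integrable M (\<lambda>x. f x * g x)"
    and "(\<integral>x. \<bar>f x * g x\<bar> \<partial>M)
      \<le> (\<integral>x. \<bar>f x\<bar> powr p \<partial>M) powr (1 / p) * (\<integral>x. \<bar>g x\<bar> powr q \<partial>M) powr (1 / q)"
proof -
  have young: "\<bar>a * b\<bar> \<le> \<bar>a\<bar> powr p / p + \<bar>b\<bar> powr q / q" for a b :: real
    using Youngs_inequality[OF pq, of "\<bar>a\<bar>" "\<bar>b\<bar>"] by (simp add: abs_mult)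
  show int: "integrable M (\<lambda>x. f x * g x)"
  proof (rule Bochner_Integration.integrable_bound)
    show "integrable M (\<lambda>x. \<bar>f x\<bar> powr p / p + \<bar>g x\<bar> powr q / q)"
      using fp gq by simp
    show "AE x in M. norm (f x * g x) \<le> norm (\<bar>f x\<bar> powr p / p + \<bar>g x\<bar> powr q / q)"
      by (intro AE_I2) (use young in \<open>simp add: order_trans[OF _ abs_ge_self]\<close>)
  qed simp
  define F where "F = (\<integral>x. \<bar>f x\<bar> powr p \<partial>M)"
  define G where "G = (\<integral>x. \<bar>g x\<bar> powr q \<partial>M)"
  show "(\<integral>x. \<bar>f x * g x\<bar> \<partial>M) \<le> F powr (1 / p) * G powr (1 / q)"
  proof (cases "F = 0 \<or> G = 0")
    case True
    then have "(AE x in M. \<bar>f x\<bar> powr p = 0) \<or> (AE x in M. \<bar>g x\<bar> powr q = 0)"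
      using integral_nonneg_eq_0_iff_AE[OF fp] integral_nonneg_eq_0_iff_AE[OF gq]
      by (auto simp: F_def G_def)
    then have "AE x in M. \<bar>f x * g x\<bar> = 0"
      by (auto elim: eventually_mono)
    then have "(\<integral>x. \<bar>f x * g x\<bar> \<partial>M) = (\<integral>x. 0 \<partial>M)"
      by (intro integral_cong_AE) auto
    then show ?thesis by simp
  next
    case False
    have pos: "F > 0" "G > 0"
      using False by (auto simp: F_def G_def less_le intro!: integral_nonneg_AE)
    define A where "A = F powr (1 / p)"
    define B where "B = G powr (1 / q)"
    have AB: "A > 0" "B > 0" "A powr p = F" "B powr q = G"
      using pos pq by (auto simp: A_def B_def powr_powr)
    have "(\<integral>x. \<bar>f x * g x\<bar> / (A * B) \<partial>M) \<le> (\<integral>x. \<bar>f x\<bar> powr p / (p * F) + \<bar>g x\<bar> powr q / (q * G) \<partial>M)"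
    proof (rule integral_mono)
      fix x
      show "\<bar>f x * g x\<bar> / (A * B) \<le> \<bar>f x\<bar> powr p / (p * F) + \<bar>g x\<bar> powr q / (q * G)"
        using young[of "f x / A" "g x / B"] AB
        by (simp add: abs_mult powr_divide mult.commute)
    qed (use int fp gq in auto)
    also have "\<dots> = F / (p * F) + G / (q * G)"
      using fp gq by (simp add: F_def G_def)
    also have "\<dots> = 1"
      using pos pq by simp
    finally have "(\<integral>x. \<bar>f x * g x\<bar> \<partial>M) / (A * B) \<le> 1" by simp
    then show ?thesis
      using AB by (simp add: A_def B_def)
  qed
qed

text \<open>The summand 1 covers x \<le> 1, where lowering the exponent enlarges the power. It is
  integrable on a set of finite measure, which is how L^p is embedded in L^q below.\<close>

lemma powr_le_one_plus_powr:
  fixes x :: real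
  assumes "x \<ge> 0" "0 \<le> q" "q \<le> p"
  shows "x powr q \<le> 1 + x powr p"
proof (cases "x \<le> 1")
  case True
  then have "x powr q \<le> 1" using assms by (simp add: powr_le1)
  then show ?thesis by (smt (verit) powr_ge_zero)
next
  case False
  then have "x powr q \<le> x powr p" using assms by (intro powr_mono) auto
  then show ?thesis by simp
qed

text \<open>This places the product of an L^2 and an L^p function in the dual Lebesgue space of L^p.
  The case split compares a^2 with b^p: replacing the smaller factor leaves b to the power (p/2 + 1)
  p/(p - 1), or a to the power (1 + 2/p) p/(p - 1). These exponents are at most p and at most 2
  respectively exactly when p \<ge> 4.\<close>

lemma mult_powr_conjugate_le:
  fixes a b :: real
  assumes "a \<ge> 0" "b \<ge> 0" "p \<ge> 4"
  shows "(a * b) powr (p / (p - 1)) \<le> 1 + a powr 2 + b powr p"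
proof (cases "a \<le> b powr (p / 2)")
  case True
  have "(a * b) powr (p / (p - 1)) \<le> (b powr (p / 2) * b) powr (p / (p - 1))"
    using True assms by (intro powr_mono2 mult_right_mono) auto
  also have "b powr (p / 2) * b = b powr (p / 2 + 1)"
    using assms by (simp add: powr_add)
  also have "\<dots> powr (p / (p - 1)) = b powr ((p / 2 + 1) * (p / (p - 1)))"
    by (rule powr_powr)
  also have "\<dots> \<le> 1 + b powr p"
    using assms by (intro powr_le_one_plus_powr) (auto simp: field_simps)
  finally show ?thesis by (smt (verit) powr_ge_zero)
next
  case False
  have "b \<le> a powr (2 / p)"
  proof -
    have "b = (b powr (p / 2)) powr (2 / p)"
      using assms by (simp add: powr_powr)
    also have "\<dots> \<le> a powr (2 / p)"
      using False assms by (intro powr_mono2) auto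
    finally show ?thesis .
  qed
  then have "(a * b) powr (p / (p - 1)) \<le> (a * a powr (2 / p)) powr (p / (p - 1))"
    using assms by (intro powr_mono2 mult_left_mono) auto
  also have "a * a powr (2 / p) = a powr (1 + 2 / p)"
    using assms by (simp add: powr_add)
  also have "\<dots> powr (p / (p - 1)) = a powr ((1 + 2 / p) * (p / (p - 1)))"
    by (rule powr_powr)
  also have "\<dots> \<le> 1 + a powr 2"
    using assms by (intro powr_le_one_plus_powr) (auto simp: field_simps)
  finally show ?thesis by (smt (verit) powr_ge_zero)
qed

lemma Lp_norm_nonneg: "0 \<le> Lp_norm \<Omega> p u"
  by (simp add: Lp_norm_def)

lemma Lp_norm_powr:
  assumes "p > 0"
  shows "Lp_norm \<Omega> p u powr p = (\<integral>x. norm (u x) powr p \<partial>lebesgue_on \<Omega>)"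
  using assms by (simp add: Lp_norm_def powr_powr)

lemma Lp_norm_2_squared: "(Lp_norm \<Omega> 2 u)\<^sup>2 = (\<integral>x. u x \<bullet> u x \<partial>lebesgue_on \<Omega>)"
proof -
  have "(Lp_norm \<Omega> 2 u)\<^sup>2 = Lp_norm \<Omega> 2 u powr 2"
    by (simp add: Lp_norm_nonneg powr_numeral)
  also have "\<dots> = (\<integral>x. norm (u x) powr 2 \<partial>lebesgue_on \<Omega>)"
    by (rule Lp_norm_powr) simp
  finally show ?thesis
    by (simp add: powr_numeral power2_norm_eq_inner)
qed

lemma Lp_norm_cong_AE:
  assumes "u \<in> borel_measurable (lebesgue_on \<Omega>)" "v \<in> borel_measurable (lebesgue_on \<Omega>)"
    and ae: "AE x in lebesgue_on \<Omega>. u x = v x"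
  shows "Lp_norm \<Omega> p u = Lp_norm \<Omega> p v"
proof -
  note [measurable] = assms(1,2)
  have "(\<integral>x. norm (u x) powr p \<partial>lebesgue_on \<Omega>) = (\<integral>x. norm (v x) powr p \<partial>lebesgue_on \<Omega>)"
    using ae by (intro integral_cong_AE) (auto elim: eventually_mono)
  then show ?thesis by (simp add: Lp_norm_def)
qed

lemma Lp_spaceD:
  assumes "u \<in> Lp_space \<Omega> p"
  shows "u \<in> borel_measurable (lebesgue_on \<Omega>)" "integrable (lebesgue_on \<Omega>) (\<lambda>x. norm (u x) powr p)"
  using assms by (auto simp: Lp_space_def)

lemma Lp_space_mono:
  assumes fin: "\<Omega> \<in> lmeasurable" and "0 \<le> q" "q \<le> p" and u: "u \<in> Lp_space \<Omega> p"
  shows "u \<in> Lp_space \<Omega> q"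
proof -
  interpret finite_measure "lebesgue_on \<Omega>" using fin by (rule finite_measure_lebesgue_on)
  note [measurable] = Lp_spaceD(1)[OF u]
  have "integrable (lebesgue_on \<Omega>) (\<lambda>x. norm (u x) powr q)"
  proof (rule Bochner_Integration.integrable_bound)
    show "integrable (lebesgue_on \<Omega>) (\<lambda>x. 1 + norm (u x) powr p)"
      using Lp_spaceD(2)[OF u] by simp
    show "AE x in lebesgue_on \<Omega>. norm (norm (u x) powr q) \<le> norm (1 + norm (u x) powr p)"
      using powr_le_one_plus_powr[OF norm_ge_zero assms(2,3)]
      by (intro AE_I2) (simp add: order_trans[OF _ abs_ge_self])
  qed measurable
  then show ?thesis by (simp add: Lp_space_def)
qed

section \<open>Linear function spaces and their closures\<close>

definition fun_subspace :: "('a \<Rightarrow> 'b::real_vector) set \<Rightarrow> bool" where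
  "fun_subspace S \<longleftrightarrow> (\<forall>u\<in>S. \<forall>v\<in>S. \<forall>a b. (\<lambda>x. a *\<^sub>R u x + b *\<^sub>R v x) \<in> S)"

lemma fun_subspaceD:
  "fun_subspace S \<Longrightarrow> u \<in> S \<Longrightarrow> v \<in> S \<Longrightarrow> (\<lambda>x. a *\<^sub>R u x + b *\<^sub>R v x) \<in> S"
  by (auto simp: fun_subspace_def)

lemma fun_subspace_diff:
  "fun_subspace S \<Longrightarrow> u \<in> S \<Longrightarrow> v \<in> S \<Longrightarrow> (\<lambda>x. u x - v x) \<in> S"
  using fun_subspaceD[of S u v 1 "-1"] by simp

text \<open>The sum is at most twice its larger term, and the p-th power of the larger term is at
  most the sum of both p-th powers. No convexity of the power is involved, so p \<ge> 0
  suffices.\<close>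

lemma norm_lincomb_powr_le:
  fixes x y :: "'a::real_normed_vector"
  assumes "p \<ge> 0"
  shows "norm (a *\<^sub>R x + b *\<^sub>R y) powr p
    \<le> 2 powr p * (\<bar>a\<bar> powr p * norm x powr p + \<bar>b\<bar> powr p * norm y powr p)"
proof -
  define m where "m = max (\<bar>a\<bar> * norm x) (\<bar>b\<bar> * norm y)"
  have "norm (a *\<^sub>R x + b *\<^sub>R y) \<le> 2 * m"
    using norm_triangle_ineq[of "a *\<^sub>R x" "b *\<^sub>R y"] by (auto simp: m_def)
  then have "norm (a *\<^sub>R x + b *\<^sub>R y) powr p \<le> (2 * m) powr p"
    using assms by (intro powr_mono2) auto
  also have "\<dots> = 2 powr p * m powr p"
    by (auto simp: m_def powr_mult le_max_iff_disj)
  also have "m powr p \<le> (\<bar>a\<bar> * norm x) powr p + (\<bar>b\<bar> * norm y) powr p"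
    by (cases "\<bar>a\<bar> * norm x \<le> \<bar>b\<bar> * norm y") (auto simp: m_def)
  finally show ?thesis by (simp add: powr_mult)
qed

lemma fun_subspace_Lp_space:
  assumes "p \<ge> 0"
  shows "fun_subspace (Lp_space \<Omega> p)"
  unfolding fun_subspace_def
proof (intro ballI allI)
  fix u v :: "'a \<Rightarrow> 'b" and a b :: real
  assume u: "u \<in> Lp_space \<Omega> p" and v: "v \<in> Lp_space \<Omega> p"
  note [measurable] = Lp_spaceD(1)[OF u] Lp_spaceD(1)[OF v]
  have "integrable (lebesgue_on \<Omega>) (\<lambda>x. norm (a *\<^sub>R u x + b *\<^sub>R v x) powr p)"
  proof (rule Bochner_Integration.integrable_bound)
    show "integrable (lebesgue_on \<Omega>)
        (\<lambda>x. 2 powr p * (\<bar>a\<bar> powr p * norm (u x) powr p + \<bar>b\<bar> powr p * norm (v x) powr p))"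
      using Lp_spaceD(2)[OF u] Lp_spaceD(2)[OF v] by simp
    show "AE x in lebesgue_on \<Omega>. norm (norm (a *\<^sub>R u x + b *\<^sub>R v x) powr p)
        \<le> norm (2 powr p * (\<bar>a\<bar> powr p * norm (u x) powr p + \<bar>b\<bar> powr p * norm (v x) powr p))"
      using norm_lincomb_powr_le[OF assms] by (intro AE_I2) (simp add: order_trans[OF _ abs_ge_self])
  qed measurable
  then show "(\<lambda>x. a *\<^sub>R u x + b *\<^sub>R v x) \<in> Lp_space \<Omega> p"
    by (simp add: Lp_space_def)
qed

text \<open>A quasi-norm is all that the closures below need, hence the crude constant instead of
  Minkowski's inequality.\<close>

lemma Lp_norm_lincomb_le:
  assumes p: "p \<ge> 1" and u: "u \<in> Lp_space \<Omega> p" and v: "v \<in> Lp_space \<Omega> p"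
  shows "Lp_norm \<Omega> p (\<lambda>x. a *\<^sub>R u x + b *\<^sub>R v x) \<le> 4 * (\<bar>a\<bar> * Lp_norm \<Omega> p u + \<bar>b\<bar> * Lp_norm \<Omega> p v)"
proof -
  define s where "s = \<bar>a\<bar> * Lp_norm \<Omega> p u + \<bar>b\<bar> * Lp_norm \<Omega> p v"
  have s: "\<bar>a\<bar> * Lp_norm \<Omega> p u \<le> s" "\<bar>b\<bar> * Lp_norm \<Omega> p v \<le> s" "s \<ge> 0"
    by (auto simp: s_def Lp_norm_nonneg)
  have "(\<integral>x. norm (a *\<^sub>R u x + b *\<^sub>R v x) powr p \<partial>lebesgue_on \<Omega>)
      \<le> (\<integral>x. 2 powr p * (\<bar>a\<bar> powr p * norm (u x) powr p + \<bar>b\<bar> powr p * norm (v x) powr p) \<partial>lebesgue_on \<Omega>)"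
    using p u v norm_lincomb_powr_le[of p] Lp_spaceD(2)[OF u] Lp_spaceD(2)[OF v]
      Lp_spaceD(2)[OF fun_subspaceD[OF fun_subspace_Lp_space u v, of a b]]
    by (intro integral_mono) auto
  also have "\<dots> = 2 powr p * (\<bar>a\<bar> powr p * Lp_norm \<Omega> p u powr p + \<bar>b\<bar> powr p * Lp_norm \<Omega> p v powr p)"
    using p Lp_spaceD(2)[OF u] Lp_spaceD(2)[OF v] by (simp add: Lp_norm_powr)
  also have "\<dots> = 2 powr p * ((\<bar>a\<bar> * Lp_norm \<Omega> p u) powr p + (\<bar>b\<bar> * Lp_norm \<Omega> p v) powr p)"
    by (simp add: powr_mult Lp_norm_nonneg)
  also have "\<dots> \<le> 2 powr p * (s powr p + s powr p)"
    using s p by (intro mult_left_mono add_mono powr_mono2) (auto simp: Lp_norm_nonneg)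
  also have "\<dots> = 2 powr p * 2 powr 1 * s powr p" by simp
  \<comment> \<open>Here p \<ge> 1 is used: the factor 2 from adding two equal bounds is raised to
    2^p, so that the p-th root yields the constant 4.\<close>
  also have "\<dots> \<le> 2 powr p * 2 powr p * s powr p"
    using p by (intro mult_right_mono mult_left_mono powr_mono) auto
  also have "\<dots> = (4 * s) powr p"
    using s by (simp add: powr_mult flip: powr_mult)
  finally have "Lp_norm \<Omega> p (\<lambda>x. a *\<^sub>R u x + b *\<^sub>R v x) \<le> ((4 * s) powr p) powr (1 / p)"
    unfolding Lp_norm_def using p by (intro powr_mono2) (auto intro: integral_nonneg_AE)
  then show ?thesis
    using p s by (simp add: powr_powr s_def)
qed

text \<open>The ambient space \<open>F\<close> is separate from \<open>E\<close> because the
  quasi-triangle inequality is applied to differences u - \<phi> with u in \<open>E\<close> and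
  \<phi> in \<open>S\<close>. With nested closures such as \<open>V_space\<close> it is enough that
  both lie in \<open>H1_space\<close>.\<close>

lemma fun_subspace_norm_closure:
  assumes E: "fun_subspace E" and S: "fun_subspace S" and F: "fun_subspace F"
    and sub: "E \<subseteq> F" "S \<subseteq> F" and "C \<ge> 0"
    and N: "\<And>u v a b. u \<in> F \<Longrightarrow> v \<in> F \<Longrightarrow>
      N (\<lambda>x. a *\<^sub>R u x + b *\<^sub>R v x) \<le> C * (\<bar>a\<bar> * N u + \<bar>b\<bar> * N v)"
  shows "fun_subspace (norm_closure E N S)"
  unfolding fun_subspace_def
proof (intro ballI allI)
  fix u v a b
  assume u: "u \<in> norm_closure E N S" and v: "v \<in> norm_closure E N S"
  have "\<exists>\<phi>\<in>S. N (\<lambda>x. (a *\<^sub>R u x + b *\<^sub>R v x) - \<phi> x) < \<epsilon>" if "\<epsilon> > 0" for \<epsilon>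
  proof -
    \<comment> \<open>The added 1 makes \<open>c\<close> positive and the final estimate (c - 1)
      (\<epsilon> / c) strictly smaller than \<epsilon>.\<close>
    define c where "c = C * (\<bar>a\<bar> + \<bar>b\<bar>) + 1"
    have c: "c > 0" using \<open>C \<ge> 0\<close> by (simp add: c_def add_nonneg_pos)
    then have \<delta>: "\<epsilon> / c > 0" using that by simp
    obtain \<phi> where \<phi>: "\<phi> \<in> S" "N (\<lambda>x. u x - \<phi> x) < \<epsilon> / c"
      using u \<delta> unfolding norm_closure_def by blast
    obtain \<psi> where \<psi>: "\<psi> \<in> S" "N (\<lambda>x. v x - \<psi> x) < \<epsilon> / c"
      using v \<delta> unfolding norm_closure_def by blast
    have "(\<lambda>x. u x - \<phi> x) \<in> F" "(\<lambda>x. v x - \<psi> x) \<in> F"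
      using u v \<phi> \<psi> sub by (auto simp: norm_closure_def intro!: fun_subspace_diff[OF F])
    then have "N (\<lambda>x. a *\<^sub>R (u x - \<phi> x) + b *\<^sub>R (v x - \<psi> x))
        \<le> C * (\<bar>a\<bar> * N (\<lambda>x. u x - \<phi> x) + \<bar>b\<bar> * N (\<lambda>x. v x - \<psi> x))"
      by (rule N)
    also have "\<dots> \<le> C * (\<bar>a\<bar> * (\<epsilon> / c) + \<bar>b\<bar> * (\<epsilon> / c))"
      using \<phi> \<psi> \<open>C \<ge> 0\<close> by (intro mult_left_mono add_mono) auto
    also have "\<dots> = (c - 1) * (\<epsilon> / c)"
      by (simp add: c_def distrib_left distrib_right add_divide_distrib)
    also have "\<dots> < \<epsilon>"
      using c that by (simp add: field_simps)
    finally show ?thesis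
      using fun_subspaceD[OF S \<phi>(1) \<psi>(1), of a b]
      by (intro bexI[of _ "\<lambda>x. a *\<^sub>R \<phi> x + b *\<^sub>R \<psi> x"]) (auto simp: algebra_simps)
  qed
  then show "(\<lambda>x. a *\<^sub>R u x + b *\<^sub>R v x) \<in> norm_closure E N S"
    using u v E by (simp add: norm_closure_def fun_subspaceD)
qed

text \<open>All integrals of products below are estimated through this form: the integrand
  \<open>m\<close> may be any measurable expression, as long as it is dominated by a product of two
  norms.\<close>

lemma Holder_Lp_bound:
  fixes m :: "'a::euclidean_space \<Rightarrow> real" and u :: "'a \<Rightarrow> 'b::euclidean_space"
    and v :: "'a \<Rightarrow> 'c::euclidean_space"
  assumes pq: "p > 1" "q > 1" "1 / p + 1 / q = 1" and "C \<ge> 0"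
    and u: "u \<in> Lp_space \<Omega> p" and v: "v \<in> Lp_space \<Omega> q"
    and m: "m \<in> borel_measurable (lebesgue_on \<Omega>)"
    and le: "\<And>x. x \<in> \<Omega> \<Longrightarrow> \<bar>m x\<bar> \<le> C * (norm (u x) * norm (v x))"
  shows "integrable (lebesgue_on \<Omega>) m"
    and "\<bar>\<integral>x. m x \<partial>lebesgue_on \<Omega>\<bar> \<le> C * (Lp_norm \<Omega> p u * Lp_norm \<Omega> q v)"
proof -
  note [measurable] = Lp_spaceD(1)[OF u] Lp_spaceD(1)[OF v]
  note H = Holder_inequality[OF pq, of "\<lambda>x. norm (u x)" "lebesgue_on \<Omega>" "\<lambda>x. norm (v x)", simplified,
      OF Lp_spaceD(2)[OF u] Lp_spaceD(2)[OF v]]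
  have int: "integrable (lebesgue_on \<Omega>) (\<lambda>x. C * (norm (u x) * norm (v x)))"
    using H(1) by simp
  then show mi: "integrable (lebesgue_on \<Omega>) m"
    by (rule Bochner_Integration.integrable_bound[OF _ m])
      (use le \<open>C \<ge> 0\<close> in \<open>auto intro!: AE_I2\<close>)
  have "\<bar>\<integral>x. m x \<partial>lebesgue_on \<Omega>\<bar> \<le> (\<integral>x. \<bar>m x\<bar> \<partial>lebesgue_on \<Omega>)"
    by (rule integral_abs_bound)
  also have "\<dots> \<le> (\<integral>x. C * (norm (u x) * norm (v x)) \<partial>lebesgue_on \<Omega>)"
    using mi int le by (intro integral_mono) auto
  also have "\<dots> \<le> C * (Lp_norm \<Omega> p u * Lp_norm \<Omega> q v)"
    using \<open>C \<ge> 0\<close> by (auto simp: Lp_norm_def abs_mult intro!: mult_left_mono H(2))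
  finally show "\<bar>\<integral>x. m x \<partial>lebesgue_on \<Omega>\<bar> \<le> C * (Lp_norm \<Omega> p u * Lp_norm \<Omega> q v)" .
qed

lemma norm_mult_norm_in_Lp_space:
  assumes fin: "\<Omega> \<in> lmeasurable" and p: "p \<ge> 4"
    and u: "u \<in> Lp_space \<Omega> 2" and v: "v \<in> Lp_space \<Omega> p"
  shows "(\<lambda>x. norm (u x) * norm (v x)) \<in> Lp_space \<Omega> (p / (p - 1))"
proof -
  interpret finite_measure "lebesgue_on \<Omega>" using fin by (rule finite_measure_lebesgue_on)
  note [measurable] = Lp_spaceD(1)[OF u] Lp_spaceD(1)[OF v]
  have "integrable (lebesgue_on \<Omega>) (\<lambda>x. (norm (u x) * norm (v x)) powr (p / (p - 1)))"
  proof (rule Bochner_Integration.integrable_bound)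
    show "integrable (lebesgue_on \<Omega>) (\<lambda>x. 1 + norm (u x) powr 2 + norm (v x) powr p)"
      using Lp_spaceD(2)[OF u] Lp_spaceD(2)[OF v] by simp
    show "AE x in lebesgue_on \<Omega>. norm ((norm (u x) * norm (v x)) powr (p / (p - 1)))
        \<le> norm (1 + norm (u x) powr 2 + norm (v x) powr p)"
      using mult_powr_conjugate_le[OF norm_ge_zero norm_ge_zero p]
      by (intro AE_I2) (simp add: order_trans[OF _ abs_ge_self])
  qed measurable
  then show ?thesis by (simp add: Lp_space_def abs_mult)
qed

section \<open>Weak gradients\<close>

lemma borel_measurable_vec_nth[measurable (raw)]:
  fixes f :: "'a \<Rightarrow> 'b::{second_countable_topology, real_normed_vector}^'n"
  assumes "f \<in> borel_measurable M"
  shows "(\<lambda>x. f x $ i) \<in> borel_measurable M"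
  by (rule borel_measurable_continuous_on[OF _ assms]) (intro continuous_intros)

lemma borel_measurable_matrix_vector_inner[measurable (raw)]:
  fixes D :: "'a \<Rightarrow> real^'n^'n"
  assumes [measurable]: "D \<in> borel_measurable M" "u \<in> borel_measurable M" "w \<in> borel_measurable M"
  shows "(\<lambda>x. (D x *v u x) \<bullet> w x) \<in> borel_measurable M"
  unfolding inner_vec_def matrix_mult_dot by simp

text \<open>The norm of a matrix here is that of Frobenius; Cauchy-Schwarz in each row shows that it
  dominates the operator norm.\<close>

lemma norm_matrix_vector_mult_le:
  fixes D :: "real^'n^'m"
  shows "norm (D *v x) \<le> norm D * norm x"
proof -
  have "norm ((D *v x) $ i) \<le> norm (D $ i) * norm x" for i
    by (simp add: matrix_mult_dot Cauchy_Schwarz_ineq2)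
  then have "norm (D *v x) \<le> L2_set (\<lambda>i. norm (D $ i) * norm x) UNIV"
    unfolding norm_vec_def[of "D *v x"] by (intro L2_set_mono) auto
  then show ?thesis
    by (simp add: norm_vec_def[of D] L2_set_left_distrib)
qed

lemma abs_matrix_vector_inner_le:
  fixes D :: "real^'n^'n"
  shows "\<bar>(D *v u) \<bullet> w\<bar> \<le> norm D * norm u * norm w"
proof -
  have "\<bar>(D *v u) \<bullet> w\<bar> \<le> norm (D *v u) * norm w"
    by (rule Cauchy_Schwarz_ineq2)
  also have "\<dots> \<le> norm D * norm u * norm w"
    by (intro mult_right_mono norm_matrix_vector_mult_le) simp
  finally show ?thesis .
qed

lemma smoothD:
  assumes "smooth \<phi>"
  shows "continuous_on UNIV \<phi>" "\<phi> differentiable (at x)"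
    and "e \<in> Basis \<Longrightarrow> continuous_on UNIV (\<lambda>x. frechet_derivative \<phi> (at x) e)"
proof -
  have "Ck_on 0 UNIV \<phi>" "Ck_on (Suc 0) UNIV \<phi>"
    using assms unfolding smooth_def by blast+
  then show "continuous_on UNIV \<phi>" "\<phi> differentiable (at x)"
    and "e \<in> Basis \<Longrightarrow> continuous_on UNIV (\<lambda>x. frechet_derivative \<phi> (at x) e)"
    by auto
qed

lemma continuous_on_partial:
  fixes \<phi> :: "real^'n \<Rightarrow> 'b::real_normed_vector"
  assumes "smooth \<phi>"
  shows "continuous_on UNIV (\<lambda>x. frechet_derivative \<phi> (at x) (axis j 1))"
  by (rule smoothD(3)[OF assms]) simp

lemma test_functionsE:
  assumes "\<phi> \<in> test_functions \<Omega>"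
  obtains K where "compact K" "K \<subseteq> \<Omega>" "smooth \<phi>" "\<And>x. x \<notin> K \<Longrightarrow> \<phi> x = 0"
    "\<And>x. x \<notin> K \<Longrightarrow> frechet_derivative \<phi> (at x) = (\<lambda>_. 0)"
proof -
  obtain K where K: "compact K" "K \<subseteq> \<Omega>" "smooth \<phi>" "\<And>x. x \<notin> K \<Longrightarrow> \<phi> x = 0"
    using assms by (auto simp: test_functions_def)
  moreover have "frechet_derivative \<phi> (at x) = (\<lambda>_. 0)" if "x \<notin> K" for x
    using K that by (intro frechet_derivative_outside_support) (auto intro: compact_imp_closed)
  ultimately show ?thesis using that by blast
qed

lemma continuous_compact_support_bounded:
  fixes f :: "'a::euclidean_space \<Rightarrow> 'b::real_normed_vector"
  assumes "continuous_on UNIV f" "compact K" "\<And>x. x \<notin> K \<Longrightarrow> f x = 0"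
  obtains M where "M \<ge> 0" "\<And>x. norm (f x) \<le> M"
proof -
  have "bounded (f ` K)"
    using assms by (meson compact_continuous_image compact_imp_bounded continuous_on_subset subset_UNIV)
  then obtain M where "\<forall>x\<in>K. norm (f x) \<le> M"
    by (auto simp: bounded_iff)
  then have "norm (f x) \<le> max M 0" for x
    using assms(3)[of x] by (cases "x \<in> K") auto
  then show ?thesis using that[of "max M 0"] by simp
qed

lemma continuous_imp_measurable_lebesgue_on:
  fixes f :: "'a::euclidean_space \<Rightarrow> 'b::euclidean_space"
  assumes "continuous_on UNIV f"
  shows "f \<in> borel_measurable (lebesgue_on S)"
  by (intro measurable_restrict_space1 measurable_completion)
    (use assms in \<open>simp add: borel_measurable_continuous_onI\<close>)

text \<open>Local integrability controls f on \<open>K\<close> only. Since \<psi> vanishes off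
  \<open>K\<close>, f may be extended by 0 there without changing the product.\<close>

lemma integrable_times_compact_support:
  fixes f \<psi> :: "'a::euclidean_space \<Rightarrow> real"
  assumes meas: "\<Omega> \<in> sets lebesgue" and K: "compact K" "K \<subseteq> \<Omega>"
    and f: "integrable (lebesgue_on K) f"
    and \<psi>: "continuous_on UNIV \<psi>" "\<And>x. x \<notin> K \<Longrightarrow> \<psi> x = 0"
  shows "integrable (lebesgue_on \<Omega>) (\<lambda>x. f x * \<psi> x)"
proof -
  obtain M where M: "\<And>x. \<bar>\<psi> x\<bar> \<le> M"
    using continuous_compact_support_bounded[OF \<psi>(1) K(1) \<psi>(2)] by auto
  have Kleb: "K \<in> sets lebesgue"
    using K by (simp add: lmeasurable_compact fmeasurableD)
  then have fi: "integrable lebesgue (\<lambda>x. indicator K x * f x)"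
    using f by (simp add: integrable_restrict_space)
  have "\<psi> \<in> borel_measurable lebesgue"
    using continuous_imp_measurable_lebesgue_on[OF \<psi>(1), of UNIV] by (simp add: lebesgue_on_UNIV_eq)
  then have "(\<lambda>x. (indicator K x * f x) * \<psi> x) \<in> borel_measurable lebesgue"
    using fi by (intro borel_measurable_times[OF borel_measurable_integrable])
  moreover have "integrable lebesgue (\<lambda>x. M * (indicator K x * f x))"
    using fi by simp
  moreover have "norm ((indicator K x * f x) * \<psi> x) \<le> norm (M * (indicator K x * f x))" for x
  proof -
    have "\<bar>indicator K x * f x\<bar> * \<bar>\<psi> x\<bar> \<le> \<bar>indicator K x * f x\<bar> * \<bar>M\<bar>"
      by (intro mult_left_mono order_trans[OF M abs_ge_self]) simp
    then show ?thesis by (simp add: abs_mult mult.commute)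
  qed
  ultimately have "integrable lebesgue (\<lambda>x. (indicator K x * f x) * \<psi> x)"
    by (blast intro: Bochner_Integration.integrable_bound)
  moreover have "(indicator K x * f x) * \<psi> x = indicator \<Omega> x * (f x * \<psi> x)" for x
    using K \<psi>(2)[of x] by (auto simp: indicator_def)
  ultimately show ?thesis
    using meas by (simp add: integrable_restrict_space)
qed

lemma integral_lebesgue_on_eq_lborel:
  fixes g :: "'a::euclidean_space \<Rightarrow> real"
  assumes "\<Omega> \<in> sets lebesgue" and "K \<subseteq> \<Omega>" and [measurable]: "g \<in> borel_measurable borel"
    and "\<And>x. x \<notin> K \<Longrightarrow> g x = 0"
  shows "(\<integral>x. g x \<partial>lebesgue_on \<Omega>) = (\<integral>x. g x \<partial>lborel)"
proof -
  have "(\<integral>x. g x \<partial>lebesgue_on \<Omega>) = (\<integral>x. indicator \<Omega> x * g x \<partial>lebesgue)"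
    using assms by (simp add: integral_restrict_space)
  also have "(\<lambda>x. indicator \<Omega> x * g x) = g"
    using assms by (auto simp: fun_eq_iff indicator_def)
  finally show ?thesis
    by (simp add: integral_completion)
qed

lemma locally_integrable_bounded_linear:
  assumes "bounded_linear T" "locally_integrable \<Omega> u"
  shows "locally_integrable \<Omega> (\<lambda>x. T (u x))"
  using assms by (auto simp: locally_integrable_def integrable_bounded_linear)

lemma locally_integrable_lincomb:
  assumes "locally_integrable \<Omega> u" "locally_integrable \<Omega> v"
  shows "locally_integrable \<Omega> (\<lambda>x. a *\<^sub>R u x + b *\<^sub>R v x)"
  using assms by (auto simp: locally_integrable_def)

lemma continuous_imp_locally_integrable:
  fixes f :: "'a::euclidean_space \<Rightarrow> 'b::euclidean_space"
  assumes "continuous_on UNIV f"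
  shows "locally_integrable \<Omega> f"
  unfolding locally_integrable_def
proof (intro allI impI)
  fix K assume "compact K \<and> K \<subseteq> \<Omega>"
  then have K: "compact K" by simp
  interpret finite_measure "lebesgue_on K"
    using K by (intro finite_measure_lebesgue_on lmeasurable_compact)
  have "bounded (f ` K)"
    using assms K by (meson compact_continuous_image compact_imp_bounded continuous_on_subset subset_UNIV)
  then obtain M where "\<forall>x\<in>K. norm (f x) \<le> M"
    by (auto simp: bounded_iff)
  then show "integrable (lebesgue_on K) f"
    using continuous_imp_measurable_lebesgue_on[OF assms]
    by (intro integrable_const_bound[of _ M]) auto
qed

text \<open>Preimages are glued from countably many compact boxes. It serves the choice made by
  \<open>wgrad\<close>, of which only the property \<open>weak_gradient\<close>, and with it only
  local integrability, is known.\<close>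

lemma locally_integrable_measurable:
  fixes f :: "'a::euclidean_space \<Rightarrow> 'b::euclidean_space"
  assumes "open \<Omega>" and f: "locally_integrable \<Omega> f"
  shows "f \<in> borel_measurable (lebesgue_on \<Omega>)"
proof -
  obtain \<D> where D: "countable \<D>" "\<Union>\<D> = \<Omega>" "\<And>X. X \<in> \<D> \<Longrightarrow> \<exists>a b. X = cbox a b"
    using open_countable_Union_open_cbox[OF \<open>open \<Omega>\<close>] by metis
  have "{x \<in> \<Omega>. f x \<in> T} \<in> sets lebesgue" if T: "T \<in> sets borel" for T
  proof -
    have "{x \<in> X. f x \<in> T} \<in> sets lebesgue" if X: "X \<in> \<D>" for X
    proof -
      obtain a b where ab: "X = cbox a b" using D(3) X by blast
      have "f \<in> borel_measurable (lebesgue_on X)"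
        using f X ab D(2) unfolding locally_integrable_def
        by (metis Union_upper compact_cbox borel_measurable_integrable)
      then show ?thesis
        using T ab by (auto simp: borel_measurable_vimage_borel sets_restrict_space_iff)
    qed
    then have "(\<Union>X\<in>\<D>. {x \<in> X. f x \<in> T}) \<in> sets lebesgue"
      using D(1) by (intro sets.countable_UN') auto
    also have "(\<Union>X\<in>\<D>. {x \<in> X. f x \<in> T}) = {x \<in> \<Omega>. f x \<in> T}"
      using D(2) by auto
    finally show ?thesis .
  qed
  then show ?thesis
    using \<open>open \<Omega>\<close> by (simp add: borel_measurable_vimage_borel sets_restrict_space_iff)
qed

section \<open>Linearity and uniqueness of weak gradients\<close>

lemma weak_gradientD:
  assumes "weak_gradient \<Omega> u D"
  shows "locally_integrable \<Omega> u" "locally_integrable \<Omega> D"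
    and "\<psi> \<in> test_functions \<Omega> \<Longrightarrow>
      (\<integral>x. u x $ i * frechet_derivative \<psi> (at x) (axis j 1) \<partial>lebesgue_on \<Omega>)
        = - (\<integral>x. D x $ i $ j * \<psi> x \<partial>lebesgue_on \<Omega>)"
  using assms by (auto simp: weak_gradient_def)

text \<open>The equation in \<open>weak_gradient\<close> by itself says nothing about integrability,
  as a Bochner integral that fails to exist has the value 0. Splitting such integrals over sums
  rests on these two facts.\<close>

lemma weak_gradient_integrable:
  assumes "open \<Omega>" "weak_gradient \<Omega> u D" "\<psi> \<in> test_functions \<Omega>"
  shows "integrable (lebesgue_on \<Omega>) (\<lambda>x. u x $ i * frechet_derivative \<psi> (at x) (axis j 1))"
    and "integrable (lebesgue_on \<Omega>) (\<lambda>x. D x $ i $ j * \<psi> x)"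
proof -
  obtain K where K: "compact K" "K \<subseteq> \<Omega>" "smooth \<psi>" "\<And>x. x \<notin> K \<Longrightarrow> \<psi> x = 0"
    "\<And>x. x \<notin> K \<Longrightarrow> frechet_derivative \<psi> (at x) = (\<lambda>_. 0)"
    using test_functionsE[OF assms(3)] by metis
  have "locally_integrable \<Omega> (\<lambda>x. u x $ i)"
    by (rule locally_integrable_bounded_linear[OF _ weak_gradientD(1)[OF assms(2)]]) (rule bounded_linear_vec_nth)
  moreover have "locally_integrable \<Omega> (\<lambda>x. D x $ i $ j)"
    by (rule locally_integrable_bounded_linear[OF _ weak_gradientD(2)[OF assms(2)]])
      (rule bounded_linear_compose[OF bounded_linear_vec_nth bounded_linear_vec_nth])
  ultimately show "integrable (lebesgue_on \<Omega>) (\<lambda>x. u x $ i * frechet_derivative \<psi> (at x) (axis j 1))"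
    and "integrable (lebesgue_on \<Omega>) (\<lambda>x. D x $ i $ j * \<psi> x)"
    using K \<open>open \<Omega>\<close> continuous_on_partial[OF K(3)] smoothD(1)[OF K(3)]
    by (auto simp: locally_integrable_def intro!: integrable_times_compact_support[where K=K])
qed

lemma weak_gradient_lincomb:
  fixes \<Omega> :: "(real^'n) set"
  assumes "open \<Omega>" and u: "weak_gradient \<Omega> u Du" and v: "weak_gradient \<Omega> v Dv"
  shows "weak_gradient \<Omega> (\<lambda>x. a *\<^sub>R u x + b *\<^sub>R v x) (\<lambda>x. a *\<^sub>R Du x + b *\<^sub>R Dv x)"
  unfolding weak_gradient_def
proof (intro conjI ballI allI)
  show "locally_integrable \<Omega> (\<lambda>x. a *\<^sub>R u x + b *\<^sub>R v x)" "locally_integrable \<Omega> (\<lambda>x. a *\<^sub>R Du x + b *\<^sub>R Dv x)"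
    using u v by (auto intro: locally_integrable_lincomb weak_gradientD)
  fix \<psi> :: "real^'n \<Rightarrow> real" and i j assume \<psi>: "\<psi> \<in> test_functions \<Omega>"
  note I = weak_gradient_integrable[OF \<open>open \<Omega>\<close> u \<psi>] weak_gradient_integrable[OF \<open>open \<Omega>\<close> v \<psi>]
  let ?d = "\<lambda>x. frechet_derivative \<psi> (at x) (axis j 1)"
  have "(\<integral>x. (a *\<^sub>R u x + b *\<^sub>R v x) $ i * ?d x \<partial>lebesgue_on \<Omega>)
      = (\<integral>x. a * (u x $ i * ?d x) + b * (v x $ i * ?d x) \<partial>lebesgue_on \<Omega>)"
    by (simp add: algebra_simps)
  also have "\<dots> = a * (\<integral>x. u x $ i * ?d x \<partial>lebesgue_on \<Omega>) + b * (\<integral>x. v x $ i * ?d x \<partial>lebesgue_on \<Omega>)"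
    using I by simp
  also have "\<dots> = - (a * (\<integral>x. Du x $ i $ j * \<psi> x \<partial>lebesgue_on \<Omega>) + b * (\<integral>x. Dv x $ i $ j * \<psi> x \<partial>lebesgue_on \<Omega>))"
    by (simp add: weak_gradientD(3)[OF u \<psi>] weak_gradientD(3)[OF v \<psi>])
  also have "\<dots> = - (\<integral>x. a * (Du x $ i $ j * \<psi> x) + b * (Dv x $ i $ j * \<psi> x) \<partial>lebesgue_on \<Omega>)"
    using I by simp
  also have "\<dots> = - (\<integral>x. (a *\<^sub>R Du x + b *\<^sub>R Dv x) $ i $ j * \<psi> x \<partial>lebesgue_on \<Omega>)"
    by (simp add: algebra_simps)
  finally show "(\<integral>x. (a *\<^sub>R u x + b *\<^sub>R v x) $ i * ?d x \<partial>lebesgue_on \<Omega>)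
      = - (\<integral>x. (a *\<^sub>R Du x + b *\<^sub>R Dv x) $ i $ j * \<psi> x \<partial>lebesgue_on \<Omega>)" .
qed

text \<open>Against a test function \<psi>, corresponding entries of both gradients have the same
  integral, fixed by u alone, so the fundamental lemma applies to their difference.\<close>

lemma weak_gradient_unique:
  fixes \<Omega> :: "(real^'n) set"
  assumes "open \<Omega>" and D: "weak_gradient \<Omega> u D" and D': "weak_gradient \<Omega> u D'"
  shows "AE x in lebesgue_on \<Omega>. D x = D' x"
proof -
  have "AE x in lebesgue_on \<Omega>. D x $ i $ j - D' x $ i $ j = 0" for i j
  proof (rule fundamental_lemma_calculus_of_variations[OF \<open>open \<Omega>\<close>])
    have "locally_integrable \<Omega> (\<lambda>x. 1 *\<^sub>R D x + (-1) *\<^sub>R D' x)"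
      using D D' by (intro locally_integrable_lincomb weak_gradientD)
    from locally_integrable_bounded_linear[OF bounded_linear_compose[OF bounded_linear_vec_nth bounded_linear_vec_nth] this]
    show "locally_integrable \<Omega> (\<lambda>x. D x $ i $ j - D' x $ i $ j)"
      by simp
    fix \<psi> :: "real^'n \<Rightarrow> real" assume \<psi>: "\<psi> \<in> test_functions \<Omega>"
    have "(\<integral>x. (D x $ i $ j - D' x $ i $ j) * \<psi> x \<partial>lebesgue_on \<Omega>)
        = (\<integral>x. D x $ i $ j * \<psi> x \<partial>lebesgue_on \<Omega>) - (\<integral>x. D' x $ i $ j * \<psi> x \<partial>lebesgue_on \<Omega>)"
      using weak_gradient_integrable(2)[OF \<open>open \<Omega>\<close> D \<psi>] weak_gradient_integrable(2)[OF \<open>open \<Omega>\<close> D' \<psi>]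
      by (simp add: left_diff_distrib)
    then show "(\<integral>x. (D x $ i $ j - D' x $ i $ j) * \<psi> x \<partial>lebesgue_on \<Omega>) = 0"
      using weak_gradientD(3)[OF D \<psi>, of i j] weak_gradientD(3)[OF D' \<psi>, of i j] by simp
  qed
  then have "AE x in lebesgue_on \<Omega>. \<forall>i j. D x $ i $ j - D' x $ i $ j = 0"
    by (intro eventually_all_finite)
  then show ?thesis
    by eventually_elim (simp add: vec_eq_iff)
qed

section \<open>The space H^1\<close>

text \<open>Membership provides some square integrable weak gradient, but \<open>wgrad\<close> may
  have chosen another one; uniqueness transfers the integrability to it.\<close>

lemma H1_spaceD:
  assumes "open \<Omega>" and u: "u \<in> H1_space \<Omega>"
  shows "u \<in> Lp_space \<Omega> 2" "weak_gradient \<Omega> u (wgrad \<Omega> u)" "wgrad \<Omega> u \<in> Lp_space \<Omega> 2"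
proof -
  show "u \<in> Lp_space \<Omega> 2" using u by (simp add: H1_space_def)
  obtain D where D: "D \<in> Lp_space \<Omega> 2" "weak_gradient \<Omega> u D"
    using u by (auto simp: H1_space_def)
  then show w: "weak_gradient \<Omega> u (wgrad \<Omega> u)"
    unfolding wgrad_def by (metis someI)
  have m[measurable]: "wgrad \<Omega> u \<in> borel_measurable (lebesgue_on \<Omega>)"
    using \<open>open \<Omega>\<close> w by (intro locally_integrable_measurable weak_gradientD)
  have "AE x in lebesgue_on \<Omega>. norm (D x) powr 2 = norm (wgrad \<Omega> u x) powr 2"
    using weak_gradient_unique[OF \<open>open \<Omega>\<close> D(2) w] by eventually_elim simp
  then have "integrable (lebesgue_on \<Omega>) (\<lambda>x. norm (wgrad \<Omega> u x) powr 2)"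
    by (rule integrable_cong_AE_imp[OF Lp_spaceD(2)[OF D(1)], rotated]) measurable
  then show "wgrad \<Omega> u \<in> Lp_space \<Omega> 2"
    using m by (simp add: Lp_space_def)
qed

lemma fun_subspace_H1_space:
  assumes "open \<Omega>"
  shows "fun_subspace (H1_space \<Omega>)"
  unfolding fun_subspace_def
proof (intro ballI allI)
  fix u v a b assume uv: "u \<in> H1_space \<Omega>" "v \<in> H1_space \<Omega>"
  then show "(\<lambda>x. a *\<^sub>R u x + b *\<^sub>R v x) \<in> H1_space \<Omega>"
    using H1_spaceD[OF assms uv(1)] H1_spaceD[OF assms uv(2)]
    by (auto simp: H1_space_def intro!: fun_subspaceD[OF fun_subspace_Lp_space] weak_gradient_lincomb[OF assms]
        bexI[of _ "\<lambda>x. a *\<^sub>R wgrad \<Omega> u x + b *\<^sub>R wgrad \<Omega> v x"])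
qed

lemma wgrad_lincomb:
  assumes "open \<Omega>" "u \<in> H1_space \<Omega>" "v \<in> H1_space \<Omega>"
  shows "AE x in lebesgue_on \<Omega>. wgrad \<Omega> (\<lambda>x. a *\<^sub>R u x + b *\<^sub>R v x) x = a *\<^sub>R wgrad \<Omega> u x + b *\<^sub>R wgrad \<Omega> v x"
  using assms
  by (intro weak_gradient_unique[OF assms(1), where u="\<lambda>x. a *\<^sub>R u x + b *\<^sub>R v x"]
      weak_gradient_lincomb H1_spaceD fun_subspaceD fun_subspace_H1_space)

lemma H1_norm_le:
  "Lp_norm \<Omega> 2 u \<le> H1_norm \<Omega> u" "Lp_norm \<Omega> 2 (wgrad \<Omega> u) \<le> H1_norm \<Omega> u"
  "H1_norm \<Omega> u \<le> Lp_norm \<Omega> 2 u + Lp_norm \<Omega> 2 (wgrad \<Omega> u)"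
  by (auto simp: H1_norm_def Lp_norm_nonneg real_le_rsqrt intro!: sqrt_sum_squares_le_sum)

text \<open>The constant 8 is 4 for the function plus 4 for its gradient, as the H^1 norm is at most
  the sum of the two L^2 norms.\<close>

lemma H1_norm_lincomb_le:
  assumes "open \<Omega>" and u: "u \<in> H1_space \<Omega>" and v: "v \<in> H1_space \<Omega>"
  shows "H1_norm \<Omega> (\<lambda>x. a *\<^sub>R u x + b *\<^sub>R v x) \<le> 8 * (\<bar>a\<bar> * H1_norm \<Omega> u + \<bar>b\<bar> * H1_norm \<Omega> v)"
proof -
  note Du = H1_spaceD[OF \<open>open \<Omega>\<close> u] and Dv = H1_spaceD[OF \<open>open \<Omega>\<close> v]
  have w: "(\<lambda>x. a *\<^sub>R u x + b *\<^sub>R v x) \<in> H1_space \<Omega>"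
    using u v by (rule fun_subspaceD[OF fun_subspace_H1_space[OF \<open>open \<Omega>\<close>]])
  have "Lp_norm \<Omega> 2 (wgrad \<Omega> (\<lambda>x. a *\<^sub>R u x + b *\<^sub>R v x)) = Lp_norm \<Omega> 2 (\<lambda>x. a *\<^sub>R wgrad \<Omega> u x + b *\<^sub>R wgrad \<Omega> v x)"
    using Lp_spaceD(1)[OF Du(3)] Lp_spaceD(1)[OF Dv(3)] Lp_spaceD(1)[OF H1_spaceD(3)[OF \<open>open \<Omega>\<close> w]]
    by (intro Lp_norm_cong_AE wgrad_lincomb[OF \<open>open \<Omega>\<close> u v]) auto
  also have "\<dots> \<le> 4 * (\<bar>a\<bar> * Lp_norm \<Omega> 2 (wgrad \<Omega> u) + \<bar>b\<bar> * Lp_norm \<Omega> 2 (wgrad \<Omega> v))"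
    using Du Dv by (intro Lp_norm_lincomb_le) auto
  also have "\<dots> \<le> 4 * (\<bar>a\<bar> * H1_norm \<Omega> u + \<bar>b\<bar> * H1_norm \<Omega> v)"
    by (intro mult_left_mono add_mono H1_norm_le) auto
  finally have 1: "Lp_norm \<Omega> 2 (wgrad \<Omega> (\<lambda>x. a *\<^sub>R u x + b *\<^sub>R v x)) \<le> 4 * (\<bar>a\<bar> * H1_norm \<Omega> u + \<bar>b\<bar> * H1_norm \<Omega> v)" .
  have "Lp_norm \<Omega> 2 (\<lambda>x. a *\<^sub>R u x + b *\<^sub>R v x) \<le> 4 * (\<bar>a\<bar> * Lp_norm \<Omega> 2 u + \<bar>b\<bar> * Lp_norm \<Omega> 2 v)"
    using Du Dv by (intro Lp_norm_lincomb_le) auto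
  also have "\<dots> \<le> 4 * (\<bar>a\<bar> * H1_norm \<Omega> u + \<bar>b\<bar> * H1_norm \<Omega> v)"
    by (intro mult_left_mono add_mono H1_norm_le) auto
  finally show ?thesis
    using 1 H1_norm_le(3)[of \<Omega> "\<lambda>x. a *\<^sub>R u x + b *\<^sub>R v x"] by linarith
qed

section \<open>Classical derivatives as weak gradients\<close>

lemma continuous_on_jacobian:
  fixes \<phi> :: "real^'n \<Rightarrow> real^'m"
  assumes "smooth \<phi>"
  shows "continuous_on UNIV (\<lambda>x. jacobian \<phi> (at x))"
  unfolding jacobian_def matrix_def
  using assms by (intro continuous_intros continuous_on_partial)

lemma continuous_compact_support_Lp_space:
  fixes f :: "'a::euclidean_space \<Rightarrow> 'b::euclidean_space"
  assumes "\<Omega> \<in> lmeasurable" "p \<ge> 0"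
    and f: "continuous_on UNIV f" "compact K" "\<And>x. x \<notin> K \<Longrightarrow> f x = 0"
  shows "f \<in> Lp_space \<Omega> p"
proof -
  interpret finite_measure "lebesgue_on \<Omega>" using assms(1) by (rule finite_measure_lebesgue_on)
  have m[measurable]: "f \<in> borel_measurable (lebesgue_on \<Omega>)"
    by (rule continuous_imp_measurable_lebesgue_on[OF f(1)])
  obtain M where M: "\<And>x. norm (f x) \<le> M"
    using continuous_compact_support_bounded[OF f] by blast
  have "integrable (lebesgue_on \<Omega>) (\<lambda>x. norm (f x) powr p)"
    using M \<open>p \<ge> 0\<close> by (intro integrable_const_bound[of _ "M powr p"]) (auto intro!: powr_mono2)
  then show ?thesis using m by (simp add: Lp_space_def)
qed

lemma test_functions_subset_Lp_space:
  fixes \<Omega> :: "'a::euclidean_space set"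
  assumes "\<Omega> \<in> lmeasurable" "p \<ge> 0"
  shows "(test_functions \<Omega> :: ('a \<Rightarrow> 'b::euclidean_space) set) \<subseteq> Lp_space \<Omega> p"
proof
  fix \<phi> :: "'a \<Rightarrow> 'b" assume "\<phi> \<in> test_functions \<Omega>"
  then obtain K where "compact K" "smooth \<phi>" "\<And>x. x \<notin> K \<Longrightarrow> \<phi> x = 0"
    using test_functionsE by metis
  then show "\<phi> \<in> Lp_space \<Omega> p"
    using assms by (intro continuous_compact_support_Lp_space[where K=K]) (auto intro: smoothD)
qed

lemma frechet_derivative_vec_nth:
  assumes "\<phi> differentiable (at x)"
  shows "frechet_derivative (\<lambda>x. \<phi> x $ i) (at x) = (\<lambda>e. frechet_derivative \<phi> (at x) e $ i)"
    and "(\<lambda>x. \<phi> x $ i) differentiable (at x)"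
proof -
  have "(\<phi> has_derivative frechet_derivative \<phi> (at x)) (at x)"
    using assms by (simp flip: frechet_derivative_works)
  then have D: "((\<lambda>x. \<phi> x $ i) has_derivative (\<lambda>e. frechet_derivative \<phi> (at x) e $ i)) (at x)"
    by (rule bounded_linear.has_derivative[OF bounded_linear_vec_nth])
  then show "frechet_derivative (\<lambda>x. \<phi> x $ i) (at x) = (\<lambda>e. frechet_derivative \<phi> (at x) e $ i)"
    by (rule frechet_derivative_at[symmetric])
  show "(\<lambda>x. \<phi> x $ i) differentiable (at x)"
    using D by (rule differentiableI)
qed

text \<open>Integration by parts: the partial derivative of the product of \<phi>'s component with
  \<psi> has integral 0. The compact support comes from \<psi> alone, so \<phi> may be any smooth
  field.\<close>

lemma weak_gradient_jacobian:
  fixes \<Omega> :: "(real^'n) set"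
  assumes "open \<Omega>" and \<phi>: "smooth \<phi>"
  shows "weak_gradient \<Omega> \<phi> (\<lambda>x. jacobian \<phi> (at x))"
  unfolding weak_gradient_def
proof (intro conjI ballI allI)
  show "locally_integrable \<Omega> \<phi>" "locally_integrable \<Omega> (\<lambda>x. jacobian \<phi> (at x))"
    using \<phi> by (auto intro: continuous_imp_locally_integrable smoothD continuous_on_jacobian)
  fix \<psi> :: "real^'n \<Rightarrow> real" and i j assume \<psi>: "\<psi> \<in> test_functions \<Omega>"
  obtain K where K: "compact K" "K \<subseteq> \<Omega>" "smooth \<psi>" "\<And>x. x \<notin> K \<Longrightarrow> \<psi> x = 0"
    "\<And>x. x \<notin> K \<Longrightarrow> frechet_derivative \<psi> (at x) = (\<lambda>_. 0)"
    using test_functionsE[OF \<psi>] by metis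
  let ?d = "\<lambda>x. frechet_derivative \<psi> (at x) (axis j 1)"
  have D: "frechet_derivative (\<lambda>x. \<phi> x $ i * \<psi> x) (at x) (axis j 1)
      = \<phi> x $ i * ?d x + jacobian \<phi> (at x) $ i $ j * \<psi> x" for x
    using smoothD(2)[OF \<phi>] smoothD(2)[OF K(3)]
    by (simp add: frechet_derivative_times frechet_derivative_vec_nth jacobian_def matrix_def)
  have cont: "continuous_on UNIV (\<lambda>x. \<phi> x $ i * ?d x)" "continuous_on UNIV (\<lambda>x. jacobian \<phi> (at x) $ i $ j * \<psi> x)"
    using \<phi> K(3)
    by (auto intro!: continuous_intros intro: smoothD(1) continuous_on_partial continuous_on_jacobian)
  have "(\<integral>x. frechet_derivative (\<lambda>x. \<phi> x $ i * \<psi> x) (at x) (axis j 1) \<partial>lborel) = 0"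
  proof (rule integral_directional_derivative_eq_0[OF _ _ K(1)])
    show "(\<lambda>x. \<phi> x $ i * \<psi> x) differentiable (at x)" for x
      using smoothD(2)[OF \<phi>] smoothD(2)[OF K(3)] by (intro differentiable_mult frechet_derivative_vec_nth)
    show "continuous_on UNIV (\<lambda>x. frechet_derivative (\<lambda>x. \<phi> x $ i * \<psi> x) (at x) (axis j 1))"
      unfolding D using cont by (rule continuous_on_add)
  qed (use K in auto)
  then have "(\<integral>x. \<phi> x $ i * ?d x + jacobian \<phi> (at x) $ i $ j * \<psi> x \<partial>lborel) = 0"
    by (simp add: D)
  then have "(\<integral>x. \<phi> x $ i * ?d x \<partial>lborel) = - (\<integral>x. jacobian \<phi> (at x) $ i $ j * \<psi> x \<partial>lborel)"
    using integrable_continuous_compact_support[OF cont(1) K(1)]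
      integrable_continuous_compact_support[OF cont(2) K(1)] K by simp
  \<comment> \<open>Both integrands vanish off \<open>K\<close>, which lies in \<Omega>, so
    integrals over \<Omega> and over the whole space agree.\<close>
  moreover have "(\<integral>x. g x \<partial>lebesgue_on \<Omega>) = (\<integral>x. g x \<partial>lborel)"
    if "continuous_on UNIV g" "\<And>x. x \<notin> K \<Longrightarrow> g x = 0" for g :: "real^'n \<Rightarrow> real"
    using \<open>open \<Omega>\<close> K that by (intro integral_lebesgue_on_eq_lborel[of _ K] borel_measurable_continuous_onI) auto
  ultimately show "(\<integral>x. \<phi> x $ i * ?d x \<partial>lebesgue_on \<Omega>) = - (\<integral>x. jacobian \<phi> (at x) $ i $ j * \<psi> x \<partial>lebesgue_on \<Omega>)"
    using cont K by simp
qed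

lemma test_functions_subset_H1_space:
  fixes \<Omega> :: "(real^'n) set"
  assumes "open \<Omega>" "bounded \<Omega>"
  shows "test_functions \<Omega> \<subseteq> H1_space \<Omega>"
proof
  fix \<phi> :: "real^'n \<Rightarrow> real^'n" assume \<phi>: "\<phi> \<in> test_functions \<Omega>"
  then obtain K where K: "compact K" "smooth \<phi>" "\<And>x. x \<notin> K \<Longrightarrow> frechet_derivative \<phi> (at x) = (\<lambda>_. 0)"
    using test_functionsE by metis
  have fin: "\<Omega> \<in> lmeasurable" using assms by (simp add: lmeasurable_open)
  have "(\<lambda>x. jacobian \<phi> (at x)) \<in> Lp_space \<Omega> 2"
    using K fin by (intro continuous_compact_support_Lp_space[where K=K] continuous_on_jacobian)
      (auto simp: jacobian_def matrix_def vec_eq_iff)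
  then show "\<phi> \<in> H1_space \<Omega>"
    using test_functions_subset_Lp_space[OF fin, of 2] \<phi> weak_gradient_jacobian[OF \<open>open \<Omega>\<close> K(2)]
    by (auto simp: H1_space_def)
qed

section \<open>Linearity of the function spaces\<close>

lemma fun_subspace_test_functions: "fun_subspace (test_functions \<Omega>)"
  unfolding fun_subspace_def
proof (intro ballI allI)
  fix \<phi> \<psi> :: "'a \<Rightarrow> 'b" and a b
  assume "\<phi> \<in> test_functions \<Omega>" "\<psi> \<in> test_functions \<Omega>"
  then obtain K L where "smooth \<phi>" "compact K" "K \<subseteq> \<Omega>" "\<And>x. x \<notin> K \<Longrightarrow> \<phi> x = 0"
    "smooth \<psi>" "compact L" "L \<subseteq> \<Omega>" "\<And>x. x \<notin> L \<Longrightarrow> \<psi> x = 0"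
    by (auto simp: test_functions_def)
  then show "(\<lambda>x. a *\<^sub>R \<phi> x + b *\<^sub>R \<psi> x) \<in> test_functions \<Omega>"
    unfolding test_functions_def smooth_def
    by (intro CollectI conjI allI Ck_on_lincomb exI[of _ "K \<union> L"] compact_Un) auto
qed

lemma solenoidal_testsD:
  assumes "\<phi> \<in> solenoidal_tests \<Omega>"
  shows "\<phi> \<in> test_functions \<Omega>" "smooth \<phi>" "divergence \<phi> x = 0"
  using assms by (auto simp: solenoidal_tests_def test_functions_def)

lemma fun_subspace_solenoidal_tests:
  fixes \<Omega> :: "(real^'n) set"
  shows "fun_subspace (solenoidal_tests \<Omega>)"
  unfolding fun_subspace_def
proof (intro ballI allI)
  fix \<phi> \<psi> :: "real^'n \<Rightarrow> real^'n" and a b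
  assume \<phi>: "\<phi> \<in> solenoidal_tests \<Omega>" and \<psi>: "\<psi> \<in> solenoidal_tests \<Omega>"
  have "divergence (\<lambda>x. a *\<^sub>R \<phi> x + b *\<^sub>R \<psi> x) x = a * divergence \<phi> x + b * divergence \<psi> x" for x
    using smoothD(2)[OF solenoidal_testsD(2)[OF \<phi>]] smoothD(2)[OF solenoidal_testsD(2)[OF \<psi>]]
    by (simp add: divergence_def frechet_derivative_lincomb sum.distrib sum_distrib_left)
  then show "(\<lambda>x. a *\<^sub>R \<phi> x + b *\<^sub>R \<psi> x) \<in> solenoidal_tests \<Omega>"
    using \<phi> \<psi> fun_subspaceD[OF fun_subspace_test_functions]
    by (auto simp: solenoidal_tests_def)
qed

lemma norm_closure_subset: "norm_closure E N S \<subseteq> E"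
  by (auto simp: norm_closure_def)

lemma V_space_subset_H1_space: "V_space \<Omega> \<subseteq> H1_space \<Omega>"
  unfolding V_space_def H10_space_def by (meson norm_closure_subset order_trans)

lemma Lsol_space_subset_Lp_space: "Lsol_space \<Omega> p \<subseteq> Lp_space \<Omega> p"
  unfolding Lsol_space_def by (rule norm_closure_subset)

lemma fun_subspace_V_space:
  assumes "open \<Omega>" "bounded \<Omega>"
  shows "fun_subspace (V_space \<Omega>)"
proof -
  note H1 = fun_subspace_H1_space[OF assms(1)] and test = test_functions_subset_H1_space[OF assms]
  have "fun_subspace (H10_space \<Omega>)"
    unfolding H10_space_def
    using test
    by (intro fun_subspace_norm_closure[where F="H1_space \<Omega>" and C=8] H1
        fun_subspace_test_functions H1_norm_lincomb_le[OF assms(1)]) auto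
  moreover have "H10_space \<Omega> \<subseteq> H1_space \<Omega>"
    unfolding H10_space_def by (rule norm_closure_subset)
  ultimately show ?thesis
    unfolding V_space_def using test
    by (intro fun_subspace_norm_closure[where F="H1_space \<Omega>" and C=8] H1
        fun_subspace_solenoidal_tests H1_norm_lincomb_le[OF assms(1)])
      (auto dest: solenoidal_testsD)
qed

lemma fun_subspace_Lsol_space:
  assumes "\<Omega> \<in> lmeasurable" "p \<ge> 1"
  shows "fun_subspace (Lsol_space \<Omega> p)"
  unfolding Lsol_space_def
  using test_functions_subset_Lp_space[OF assms(1), of p] assms(2)
  by (intro fun_subspace_norm_closure[where F="Lp_space \<Omega> p" and C=4] fun_subspace_Lp_space
      fun_subspace_solenoidal_tests Lp_norm_lincomb_le) (auto dest: solenoidal_testsD)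

lemma fun_subspace_VL_space:
  assumes "open \<Omega>" "bounded \<Omega>" "p \<ge> 1"
  shows "fun_subspace (VL_space \<Omega> p)"
  using fun_subspace_V_space[OF assms(1,2)] fun_subspace_Lsol_space[of \<Omega> p] assms
  by (auto simp: VL_space_def fun_subspace_def lmeasurable_open)

lemma VL_spaceD:
  assumes "open \<Omega>" and u: "u \<in> VL_space \<Omega> p"
  shows "u \<in> V_space \<Omega>" "u \<in> Lsol_space \<Omega> p" "u \<in> H1_space \<Omega>" "u \<in> Lp_space \<Omega> p"
    and "u \<in> borel_measurable (lebesgue_on \<Omega>)" "wgrad \<Omega> u \<in> borel_measurable (lebesgue_on \<Omega>)"
    and "wgrad \<Omega> u \<in> Lp_space \<Omega> 2"
proof -
  show 1: "u \<in> V_space \<Omega>" "u \<in> Lsol_space \<Omega> p" using u by (auto simp: VL_space_def)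
  show 2: "u \<in> H1_space \<Omega>" "u \<in> Lp_space \<Omega> p"
    using 1 V_space_subset_H1_space Lsol_space_subset_Lp_space by blast+
  show "u \<in> borel_measurable (lebesgue_on \<Omega>)" using 2 Lp_spaceD by blast
  show "wgrad \<Omega> u \<in> Lp_space \<Omega> 2" by (rule H1_spaceD(3)[OF \<open>open \<Omega>\<close> 2(1)])
  then show "wgrad \<Omega> u \<in> borel_measurable (lebesgue_on \<Omega>)" using Lp_spaceD by blast
qed

section \<open>The trilinear form vanishes on the diagonal\<close>

text \<open>The expansion is by columns because column j of a Jacobian is the partial derivative in
  direction j.\<close>

lemma matrix_vector_inner_sum:
  fixes D :: "real^'n^'n"
  shows "(D *v v) \<bullet> w = (\<Sum>j\<in>UNIV. v $ j * (w \<bullet> column j D))"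
proof -
  have "(D *v v) \<bullet> w = (\<Sum>i\<in>UNIV. \<Sum>j\<in>UNIV. D $ i $ j * v $ j * w $ i)"
    by (simp add: inner_vec_def matrix_vector_mult_def sum_distrib_right)
  also have "\<dots> = (\<Sum>j\<in>UNIV. \<Sum>i\<in>UNIV. D $ i $ j * v $ j * w $ i)"
    by (rule sum.swap)
  also have "\<dots> = (\<Sum>j\<in>UNIV. v $ j * (w \<bullet> column j D))"
    by (simp add: inner_vec_def column_def sum_distrib_left mult_ac)
  finally show ?thesis .
qed

text \<open>The integrand is the divergence of \<open>\<bar>\<phi>\<bar>\<^sup>2 v / 2\<close>.\<close>

lemma trilinear_jacobian_eq_0:
  fixes \<Omega> :: "(real^'n) set" and \<phi> :: "real^'n \<Rightarrow> real^'n"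
  assumes "open \<Omega>" and v: "v \<in> solenoidal_tests \<Omega>" and \<phi>: "smooth \<phi>"
  shows "(\<integral>x. (jacobian \<phi> (at x) *v v x) \<bullet> \<phi> x \<partial>lebesgue_on \<Omega>) = 0"
proof -
  obtain K where K: "compact K" "K \<subseteq> \<Omega>" "smooth v" "\<And>x. x \<notin> K \<Longrightarrow> v x = 0"
    "\<And>x. x \<notin> K \<Longrightarrow> frechet_derivative v (at x) = (\<lambda>_. 0)"
    using test_functionsE[OF solenoidal_testsD(1)[OF v]] by metis
  define F where "F j x = (\<phi> x \<bullet> \<phi> x) * v x $ j" for j x
  \<comment> \<open>The product rule for the derivative of \<open>F j\<close> in direction j. Summed
    over j, the first terms give the squared norm of \<phi> times the divergence of v, which is 0,
    and the second terms give twice the integrand.\<close>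
  define D where "D j x = (\<phi> x \<bullet> \<phi> x) * (frechet_derivative v (at x) (axis j 1) $ j)
      + 2 * (\<phi> x \<bullet> frechet_derivative \<phi> (at x) (axis j 1)) * v x $ j" for j x
  have "(\<phi> has_derivative frechet_derivative \<phi> (at x)) (at x)" for x
    using smoothD(2)[OF \<phi>] by (simp flip: frechet_derivative_works)
  then have sq: "((\<lambda>x. \<phi> x \<bullet> \<phi> x) has_derivative (\<lambda>e. 2 * (\<phi> x \<bullet> frechet_derivative \<phi> (at x) e))) (at x)" for x
    by (auto intro!: derivative_eq_intros simp: inner_commute)
  have sqd: "(\<lambda>x. \<phi> x \<bullet> \<phi> x) differentiable (at x)" for x
    using sq by (rule differentiableI)
  have Fd: "F j differentiable (at x)" for j x
    unfolding F_def using smoothD(2)[OF K(3)] sqd by (intro differentiable_mult frechet_derivative_vec_nth)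
  have FD: "frechet_derivative (F j) (at x) (axis j 1) = D j x" for j x
    unfolding F_def D_def using smoothD(2)[OF K(3)] sqd frechet_derivative_at[OF sq[of x], symmetric]
    by (simp add: frechet_derivative_times frechet_derivative_vec_nth)
  have cont: "continuous_on UNIV (D j)" for j
    unfolding D_def using \<phi> K(3) by (intro continuous_intros smoothD(1) continuous_on_partial)
  have D0: "D j x = 0" if "x \<notin> K" for j x
    using K that by (simp add: D_def)
  have int: "integrable lborel (D j)" for j
    by (rule integrable_continuous_compact_support[OF cont K(1) D0])
  have "(\<integral>x. D j x \<partial>lborel) = 0" for j
    using integral_directional_derivative_eq_0[of "F j" "axis j 1" K] Fd cont K
    unfolding FD by (simp add: F_def)
  then have "(\<integral>x. (\<Sum>j\<in>UNIV. D j x) \<partial>lborel) = 0"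
    using int by (simp add: integral_sum)
  moreover have "(\<integral>x. (\<Sum>j\<in>UNIV. D j x) \<partial>lebesgue_on \<Omega>) = (\<integral>x. (\<Sum>j\<in>UNIV. D j x) \<partial>lborel)"
    using \<open>open \<Omega>\<close> K cont D0
    by (intro integral_lebesgue_on_eq_lborel[of _ K] borel_measurable_continuous_onI continuous_on_sum) auto
  moreover have "(\<Sum>j\<in>UNIV. D j x) = 2 * ((jacobian \<phi> (at x) *v v x) \<bullet> \<phi> x)" for x
  proof -
    have "column j (jacobian \<phi> (at x)) = frechet_derivative \<phi> (at x) (axis j 1)" for j
      by (simp add: column_def jacobian_def matrix_def vec_eq_iff)
    then have "(\<Sum>j\<in>UNIV. D j x) = (\<phi> x \<bullet> \<phi> x) * divergence v x + 2 * ((jacobian \<phi> (at x) *v v x) \<bullet> \<phi> x)"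
      unfolding matrix_vector_inner_sum
      by (simp add: D_def sum.distrib sum_distrib_left divergence_def mult_ac)
    then show ?thesis using solenoidal_testsD(3)[OF v] by simp
  qed
  ultimately show ?thesis by simp
qed

text \<open>The factors are grouped so that the bound is linear in the L^p norm of v, with
  \<open>D\<close> and w held fixed; this is the shape required for approximating v in L^p.\<close>

lemma integrable_trilinear:
  fixes \<Omega> :: "(real^'n) set" and D :: "real^'n \<Rightarrow> real^'n^'n"
  assumes fin: "\<Omega> \<in> lmeasurable" and p: "p \<ge> 4"
    and D: "D \<in> Lp_space \<Omega> 2" and v: "v \<in> Lp_space \<Omega> p" and w: "w \<in> Lp_space \<Omega> p"
  shows "integrable (lebesgue_on \<Omega>) (\<lambda>x. (D x *v v x) \<bullet> w x)"
    and "\<bar>\<integral>x. (D x *v v x) \<bullet> w x \<partial>lebesgue_on \<Omega>\<bar>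
      \<le> Lp_norm \<Omega> (p / (p - 1)) (\<lambda>x. norm (D x) * norm (w x)) * Lp_norm \<Omega> p v"
proof -
  note [measurable] = Lp_spaceD(1)[OF D] Lp_spaceD(1)[OF v] Lp_spaceD(1)[OF w]
  have pq: "p / (p - 1) > 1" "p > 1" "1 / (p / (p - 1)) + 1 / p = 1"
    using p by (auto simp: field_simps)
  have le: "\<bar>(D x *v v x) \<bullet> w x\<bar> \<le> 1 * (norm (norm (D x) * norm (w x)) * norm (v x))" for x
    using abs_matrix_vector_inner_le[of "D x" "v x" "w x"] by (simp add: abs_mult mult_ac)
  note H = Holder_Lp_bound[OF pq zero_le_one norm_mult_norm_in_Lp_space[OF fin p D w] v _ le]
  show "integrable (lebesgue_on \<Omega>) (\<lambda>x. (D x *v v x) \<bullet> w x)"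
    by (rule H(1)) measurable
  show "\<bar>\<integral>x. (D x *v v x) \<bullet> w x \<partial>lebesgue_on \<Omega>\<bar>
      \<le> Lp_norm \<Omega> (p / (p - 1)) (\<lambda>x. norm (D x) * norm (w x)) * Lp_norm \<Omega> p v"
    using H(2) by simp
qed

text \<open>The premise covers only \<epsilon> \<le> 1, so that terms quadratic in \<epsilon> can be
  absorbed into a linear bound.\<close>

lemma le_zero_if_le_mult_small:
  fixes a C :: real
  assumes "\<And>\<epsilon>. 0 < \<epsilon> \<Longrightarrow> \<epsilon> \<le> 1 \<Longrightarrow> a \<le> C * \<epsilon>"
  shows "a \<le> 0"
proof (rule tendsto_lowerbound)
  show "((\<lambda>\<epsilon>. C * \<epsilon>) \<longlongrightarrow> 0) (at_right 0)"
    by (rule tendsto_eq_intros refl)+ simp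
  show "\<forall>\<^sub>F \<epsilon> in at_right 0. a \<le> C * \<epsilon>"
    using assms by (auto simp: eventually_at_right_field intro!: exI[of _ 1])
qed simp

text \<open>A test field v is bounded, so the integral is continuous in the gradient and in the
  field, both in L^2. Approximation of w in the H^1 norm therefore reduces the claim to
  \<open>trilinear_jacobian_eq_0\<close>.\<close>

lemma trilinear_solenoidal_test_eq_0:
  fixes \<Omega> :: "(real^'n) set"
  assumes "open \<Omega>" "bounded \<Omega>" and v: "v \<in> solenoidal_tests \<Omega>" and w: "w \<in> V_space \<Omega>"
  shows "(\<integral>x. (wgrad \<Omega> w x *v v x) \<bullet> w x \<partial>lebesgue_on \<Omega>) = 0"
proof -
  have fin: "\<Omega> \<in> lmeasurable" using assms by (simp add: lmeasurable_open)
  have wH: "w \<in> H1_space \<Omega>" using w V_space_subset_H1_space by blast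
  note Dw = H1_spaceD[OF \<open>open \<Omega>\<close> wH]
  obtain M where M: "M \<ge> 0" "\<And>x. norm (v x) \<le> M"
    using test_functionsE[OF solenoidal_testsD(1)[OF v]] continuous_compact_support_bounded smoothD(1) by metis
  have vm[measurable]: "v \<in> borel_measurable (lebesgue_on \<Omega>)"
    using solenoidal_testsD[OF v] by (intro continuous_imp_measurable_lebesgue_on smoothD)
  \<comment> \<open>Stated for an arbitrary matrix field, since it is applied to
    \<open>wgrad\<close> of w and also to Jacobians and to their differences.\<close>
  have T: "integrable (lebesgue_on \<Omega>) (\<lambda>x. (D x *v v x) \<bullet> e x)"
    "\<bar>\<integral>x. (D x *v v x) \<bullet> e x \<partial>lebesgue_on \<Omega>\<bar> \<le> M * (Lp_norm \<Omega> 2 D * Lp_norm \<Omega> 2 e)"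
    if D: "D \<in> Lp_space \<Omega> 2" and e: "e \<in> Lp_space \<Omega> 2" for D :: "real^'n \<Rightarrow> real^'n^'n" and e
  proof -
    note [measurable] = Lp_spaceD(1)[OF D] Lp_spaceD(1)[OF e]
    have le: "\<bar>(D x *v v x) \<bullet> e x\<bar> \<le> M * (norm (D x) * norm (e x))" for x
    proof -
      have "\<bar>(D x *v v x) \<bullet> e x\<bar> \<le> norm (D x) * norm (v x) * norm (e x)"
        by (rule abs_matrix_vector_inner_le)
      also have "\<dots> \<le> norm (D x) * M * norm (e x)"
        using M by (intro mult_right_mono mult_left_mono) auto
      finally show ?thesis by (simp add: mult_ac)
    qed
    show "integrable (lebesgue_on \<Omega>) (\<lambda>x. (D x *v v x) \<bullet> e x)"
      by (rule Holder_Lp_bound(1)[OF _ _ _ M(1) D e _ le]) auto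
    show "\<bar>\<integral>x. (D x *v v x) \<bullet> e x \<partial>lebesgue_on \<Omega>\<bar> \<le> M * (Lp_norm \<Omega> 2 D * Lp_norm \<Omega> 2 e)"
      by (rule Holder_Lp_bound(2)[OF _ _ _ M(1) D e _ le]) auto
  qed
  define I where "I = (\<integral>x. (wgrad \<Omega> w x *v v x) \<bullet> w x \<partial>lebesgue_on \<Omega>)"
  define C where "C = M * (Lp_norm \<Omega> 2 (wgrad \<Omega> w) + Lp_norm \<Omega> 2 w + 1)"
  have "\<bar>I\<bar> \<le> C * \<epsilon>" if \<epsilon>: "0 < \<epsilon>" "\<epsilon> \<le> 1" for \<epsilon>
  proof -
    obtain \<phi> where \<phi>: "\<phi> \<in> solenoidal_tests \<Omega>" "H1_norm \<Omega> (\<lambda>x. w x - \<phi> x) < \<epsilon>"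
      using w \<epsilon>(1) unfolding V_space_def norm_closure_def by blast
    have \<phi>H: "\<phi> \<in> H1_space \<Omega>"
      using test_functions_subset_H1_space[OF assms(1,2)] solenoidal_testsD(1)[OF \<phi>(1)] by blast
    note \<phi>s = solenoidal_testsD(2)[OF \<phi>(1)]
    define e where "e x = w x - \<phi> x" for x
    \<comment> \<open>The classical Jacobian of \<phi> is subtracted instead of \<open>wgrad\<close>
      of \<phi>, because the vanishing integral is known for the former. By uniqueness
      \<open>De\<close> agrees almost everywhere with the gradient that enters the H^1 norm of
      \<open>e\<close>.\<close>
    define De where "De x = wgrad \<Omega> w x - jacobian \<phi> (at x)" for x
    have eH: "e \<in> H1_space \<Omega>"
      unfolding e_def by (rule fun_subspace_diff[OF fun_subspace_H1_space[OF \<open>open \<Omega>\<close>] wH \<phi>H])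
    have "weak_gradient \<Omega> e De"
      using weak_gradient_lincomb[OF \<open>open \<Omega>\<close> Dw(2) weak_gradient_jacobian[OF \<open>open \<Omega>\<close> \<phi>s], of 1 "-1"]
      by (simp add: e_def[abs_def] De_def[abs_def])
    then have ae: "AE x in lebesgue_on \<Omega>. wgrad \<Omega> e x = De x"
      by (rule weak_gradient_unique[OF \<open>open \<Omega>\<close> H1_spaceD(2)[OF \<open>open \<Omega>\<close> eH]])
    obtain K where "compact K" "\<And>x. x \<notin> K \<Longrightarrow> frechet_derivative \<phi> (at x) = (\<lambda>_. 0)"
      using test_functionsE[OF solenoidal_testsD(1)[OF \<phi>(1)]] by metis
    then have JL: "(\<lambda>x. jacobian \<phi> (at x)) \<in> Lp_space \<Omega> 2"
      using fin \<phi>s by (intro continuous_compact_support_Lp_space[where K=K] continuous_on_jacobian)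
        (auto simp: jacobian_def matrix_def vec_eq_iff)
    have DeL: "De \<in> Lp_space \<Omega> 2"
      unfolding De_def by (rule fun_subspace_diff[OF fun_subspace_Lp_space Dw(3) JL]) simp
    have eL: "e \<in> Lp_space \<Omega> 2" by (rule H1_spaceD(1)[OF \<open>open \<Omega>\<close> eH])
    have "Lp_norm \<Omega> 2 (wgrad \<Omega> e) = Lp_norm \<Omega> 2 De"
      by (rule Lp_norm_cong_AE[OF Lp_spaceD(1)[OF H1_spaceD(3)[OF \<open>open \<Omega>\<close> eH]] Lp_spaceD(1)[OF DeL] ae])
    then have small: "Lp_norm \<Omega> 2 De \<le> \<epsilon>" "Lp_norm \<Omega> 2 e \<le> \<epsilon>"
      using H1_norm_le(1,2)[of \<Omega> e] \<phi>(2) unfolding e_def[symmetric] by linarith+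
    have \<phi>L: "\<phi> \<in> Lp_space \<Omega> 2" by (rule H1_spaceD(1)[OF \<open>open \<Omega>\<close> \<phi>H])
    \<comment> \<open>Obtained by substituting \<phi> = w - e and its Jacobian =
      \<open>wgrad\<close> of w minus \<open>De\<close>; every term except the first contains a
      small factor.\<close>
    have split: "(wgrad \<Omega> w x *v v x) \<bullet> w x = (jacobian \<phi> (at x) *v v x) \<bullet> \<phi> x
        + (wgrad \<Omega> w x *v v x) \<bullet> e x + (De x *v v x) \<bullet> w x - (De x *v v x) \<bullet> e x" for x
      by (simp add: e_def De_def matrix_vector_mult_diff_rdistrib inner_diff_left inner_diff_right)
    have "I = (\<integral>x. (jacobian \<phi> (at x) *v v x) \<bullet> \<phi> x \<partial>lebesgue_on \<Omega>)
        + (\<integral>x. (wgrad \<Omega> w x *v v x) \<bullet> e x \<partial>lebesgue_on \<Omega>)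
        + (\<integral>x. (De x *v v x) \<bullet> w x \<partial>lebesgue_on \<Omega>) - (\<integral>x. (De x *v v x) \<bullet> e x \<partial>lebesgue_on \<Omega>)"
      unfolding I_def split using T(1)[OF JL \<phi>L] T(1)[OF Dw(3) eL] T(1)[OF DeL Dw(1)] T(1)[OF DeL eL]
      by simp
    then have "\<bar>I\<bar> \<le> M * (Lp_norm \<Omega> 2 (wgrad \<Omega> w) * Lp_norm \<Omega> 2 e)
        + M * (Lp_norm \<Omega> 2 De * Lp_norm \<Omega> 2 w) + M * (Lp_norm \<Omega> 2 De * Lp_norm \<Omega> 2 e)"
      using trilinear_jacobian_eq_0[OF \<open>open \<Omega>\<close> v \<phi>s] T(2)[OF Dw(3) eL] T(2)[OF DeL Dw(1)] T(2)[OF DeL eL]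
      by linarith
    \<comment> \<open>In the term with two small factors, one is bounded by 1 through \<epsilon>
      \<le> 1.\<close>
    also have "\<dots> \<le> M * (Lp_norm \<Omega> 2 (wgrad \<Omega> w) * \<epsilon>) + M * (\<epsilon> * Lp_norm \<Omega> 2 w) + M * (\<epsilon> * 1)"
      using small \<epsilon> M by (intro add_mono mult_left_mono mult_mono) (auto simp: Lp_norm_nonneg)
    also have "\<dots> = C * \<epsilon>" by (simp add: C_def algebra_simps)
    finally show ?thesis .
  qed
  then have "\<bar>I\<bar> \<le> 0" by (rule le_zero_if_le_mult_small)
  then show ?thesis by (simp add: I_def)
qed

text \<open>With w fixed, the form is linear and L^p-continuous in its first argument and vanishes
  on solenoidal tests, which are dense in \<open>Lsol_space\<close>.\<close>

lemma trilinear_form_diagonal_eq_0: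
  fixes \<Omega> :: "(real^'n) set"
  assumes "open \<Omega>" "bounded \<Omega>" "p \<ge> 4" and v: "v \<in> Lsol_space \<Omega> p" and w: "w \<in> VL_space \<Omega> p"
  shows "trilinear_form \<Omega> v w w = 0"
proof -
  have fin: "\<Omega> \<in> lmeasurable" using assms by (simp add: lmeasurable_open)
  note w' = VL_spaceD[OF \<open>open \<Omega>\<close> w]
  have vL: "v \<in> Lp_space \<Omega> p" using v Lsol_space_subset_Lp_space by blast
  define I where "I = trilinear_form \<Omega> v w w"
  define C where "C = Lp_norm \<Omega> (p / (p - 1)) (\<lambda>x. norm (wgrad \<Omega> w x) * norm (w x))"
  have "\<bar>I\<bar> \<le> C * \<epsilon>" if \<epsilon>: "\<epsilon> > 0" for \<epsilon>
  proof -
    obtain \<phi> where \<phi>: "\<phi> \<in> solenoidal_tests \<Omega>" "Lp_norm \<Omega> p (\<lambda>x. v x - \<phi> x) < \<epsilon>"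
      using v \<epsilon> unfolding Lsol_space_def norm_closure_def by blast
    have \<phi>L: "\<phi> \<in> Lp_space \<Omega> p"
      using test_functions_subset_Lp_space[OF fin, of p] solenoidal_testsD(1)[OF \<phi>(1)] \<open>p \<ge> 4\<close> by auto
    have dL: "(\<lambda>x. v x - \<phi> x) \<in> Lp_space \<Omega> p"
      using \<open>p \<ge> 4\<close> by (intro fun_subspace_diff[OF fun_subspace_Lp_space] vL \<phi>L) simp
    have "I = (\<integral>x. (wgrad \<Omega> w x *v (v x - \<phi> x)) \<bullet> w x \<partial>lebesgue_on \<Omega>)"
      using integrable_trilinear(1)[OF fin \<open>p \<ge> 4\<close> w'(7) vL w'(4)] integrable_trilinear(1)[OF fin \<open>p \<ge> 4\<close> w'(7) \<phi>L w'(4)]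
        trilinear_solenoidal_test_eq_0[OF assms(1,2) \<phi>(1) w'(1)]
      by (simp add: I_def trilinear_form_def matrix_vector_mult_diff_distrib inner_diff_left)
    then have "\<bar>I\<bar> \<le> C * Lp_norm \<Omega> p (\<lambda>x. v x - \<phi> x)"
      using integrable_trilinear(2)[OF fin \<open>p \<ge> 4\<close> w'(7) dL w'(4)] by (simp add: C_def)
    also have "\<dots> \<le> C * \<epsilon>"
      using \<phi>(2) by (intro mult_left_mono) (auto simp: C_def Lp_norm_nonneg)
    finally show ?thesis .
  qed
  then have "\<bar>I\<bar> \<le> 0" by (rule le_zero_if_le_mult_small)
  then show ?thesis by (simp add: I_def)
qed

section \<open>Pointwise monotonicity\<close>

text \<open>With A and B the two powers, the left side equals (A - B)(a \<bullet> a - b \<bullet>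
  b)/2 plus the right side, and the first summand is a product of two factors of the same
  sign.\<close>

lemma inner_norm_powr_diff_ge:
  fixes a b :: "'a::real_inner"
  assumes "q \<ge> 0"
  shows "(norm a powr q *\<^sub>R a - norm b powr q *\<^sub>R b) \<bullet> (a - b)
    \<ge> (norm a powr q + norm b powr q) / 2 * ((a - b) \<bullet> (a - b))"
proof -
  define A where "A = norm a powr q"
  define B where "B = norm b powr q"
  have "0 \<le> (A - B) * (a \<bullet> a - b \<bullet> b)"
  proof (cases "norm a \<le> norm b")
    case True
    then have "A \<le> B" "a \<bullet> a \<le> b \<bullet> b"
      using assms by (auto simp: A_def B_def norm_le intro!: powr_mono2)
    then show ?thesis by (simp add: mult_nonpos_nonpos)
  next
    case False
    then have "B \<le> A" "b \<bullet> b \<le> a \<bullet> a"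
      using assms by (auto simp: A_def B_def norm_le[symmetric] intro!: powr_mono2)
    then show ?thesis by simp
  qed
  moreover have "(A *\<^sub>R a - B *\<^sub>R b) \<bullet> (a - b)
      = (A - B) * (a \<bullet> a - b \<bullet> b) / 2 + (A + B) / 2 * ((a - b) \<bullet> (a - b))"
    by (simp add: inner_diff_left inner_diff_right inner_commute field_simps)
  ultimately show ?thesis by (simp add: A_def B_def)
qed

text \<open>Weighted AM-GM with equality at \<open>s = (2 / (\<beta> \<mu> (r - 1))) powr (1 / (r - 3))\<close>; this is the
  origin of the constant \<open>\<rho>\<close>.\<close>

lemma square_le_powr_plus_const:
  fixes \<mu> \<beta> r s :: real
  assumes "\<mu> > 0" "\<beta> > 0" "r > 3" "s \<ge> 0"
  shows "s\<^sup>2 / (2 * \<mu>) \<le> \<beta> / 2 * s powr (r - 1)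
    + (r - 3) / (2 * \<mu> * (r - 1)) * (2 / (\<beta> * \<mu> * (r - 1))) powr (2 / (r - 3))"
proof (cases "s = 0")
  case True
  then show ?thesis using assms by simp
next
  case False
  with assms have s: "s > 0" by simp
  \<comment> \<open>Setting the derivative of s^2/(2 \<mu>) - (\<beta>/2) s^(r - 1) to 0 gives s^(r
    - 3) = c, so \<open>s0\<close> is the maximiser and \<rho> the maximum.\<close>
  define c where "c = 2 / (\<beta> * \<mu> * (r - 1))"
  define s0 where "s0 = c powr (1 / (r - 3))"
  have c: "c > 0" and s0: "s0 > 0"
    using assms by (auto simp: c_def s0_def)
  have s0_powr: "s0 powr (r - 3) = c" "s0\<^sup>2 = c powr (2 / (r - 3))"
    using c s0 assms by (auto simp: s0_def powr_powr simp flip: powr_numeral)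
  have s0_r: "s0 powr (r - 1) = c * s0\<^sup>2"
    using s0 powr_add[of s0 "r - 3" 2] by (simp add: s0_powr(1) powr_numeral)
  define X where "X = (s / s0) powr (r - 1)"
  have X: "X > 0" "X powr (2 / (r - 1)) = (s / s0)\<^sup>2"
  proof -
    show "X > 0" using s s0 by (simp add: X_def)
    have "(r - 1) * (2 / (r - 1)) = 2" using assms by (simp add: divide_eq_eq)
    then show "X powr (2 / (r - 1)) = (s / s0)\<^sup>2"
      unfolding X_def powr_powr using s s0 by (simp add: powr_numeral)
  qed
  \<comment> \<open>Young's inequality with weights 2/(r - 1) and (r - 3)/(r - 1), which sum to 1.
    Scaling s by \<open>s0\<close> puts the case of equality at X = 1.\<close>
  have "X powr (2 / (r - 1)) * 1 powr ((r - 3) / (r - 1)) \<le> 2 / (r - 1) * X + (r - 3) / (r - 1) * 1"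
    using X assms by (intro Youngs_inequality_0) (auto simp flip: add_divide_distrib)
  then have "(s / s0)\<^sup>2 \<le> 2 / (r - 1) * X + (r - 3) / (r - 1)"
    by (simp add: X)
  then have "s0\<^sup>2 / (2 * \<mu>) * (s / s0)\<^sup>2 \<le> s0\<^sup>2 / (2 * \<mu>) * (2 / (r - 1) * X + (r - 3) / (r - 1))"
    using assms by (intro mult_left_mono) auto
  also have "X = s powr (r - 1) / (c * s0\<^sup>2)"
    using s s0 by (simp add: X_def powr_divide s0_r)
  also have "s0\<^sup>2 / (2 * \<mu>) * (2 / (r - 1) * (s powr (r - 1) / (c * s0\<^sup>2)) + (r - 3) / (r - 1))
      = 1 / (\<mu> * (r - 1) * c) * s powr (r - 1) + (r - 3) / (2 * \<mu> * (r - 1)) * s0\<^sup>2"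
  proof -
    have "s0\<^sup>2 / (2 * \<mu>) * (2 / k * (P / (c * s0\<^sup>2)) + m / k) = 1 / (\<mu> * k * c) * P + m / (2 * \<mu> * k) * s0\<^sup>2"
      if "k \<noteq> 0" for k m P :: real
      using s0 c assms that by (simp add: field_simps)
    then show ?thesis using assms by simp
  qed
  also have "1 / (\<mu> * (r - 1) * c) = \<beta> / 2"
    using assms by (simp add: c_def divide_eq_eq algebra_simps)
  finally have "s0\<^sup>2 / (2 * \<mu>) * (s / s0)\<^sup>2
      \<le> \<beta> / 2 * s powr (r - 1) + (r - 3) / (2 * \<mu> * (r - 1)) * s0\<^sup>2" .
  moreover have "s0\<^sup>2 / (2 * \<mu>) * (s / s0)\<^sup>2 = s\<^sup>2 / (2 * \<mu>)"
    using s0 by (simp add: power_divide)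
  ultimately have "s\<^sup>2 / (2 * \<mu>) \<le> \<beta> / 2 * s powr (r - 1) + (r - 3) / (2 * \<mu> * (r - 1)) * s0\<^sup>2"
    by (simp only:)
  then show ?thesis
    unfolding s0_powr(2) c_def .
qed

text \<open>\<open>D\<close> is treated as an independent matrix, so that the claim is pure algebra
  at one point. The convective term costs half of the viscous term plus a multiple of the squared
  norm of u - v; that multiple is met by \<rho> and by the share \<beta>/2 of the power of u which
  \<open>inner_norm_powr_diff_ge\<close> supplies.\<close>

lemma pointwise_monotonicity:
  fixes D :: "real^'n^'n" and u v :: "real^'n"
  assumes "\<mu> > 0" "\<beta> > 0" "r > 3"
    and \<rho>: "\<rho> = (r - 3) / (2 * \<mu> * (r - 1)) * (2 / (\<beta> * \<mu> * (r - 1))) powr (2 / (r - 3))"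
  shows "0 \<le> \<mu> * (D \<bullet> D) - (D *v (u - v)) \<bullet> u
    + \<beta> * ((norm u powr (r - 1) *\<^sub>R u - norm v powr (r - 1) *\<^sub>R v) \<bullet> (u - v))
    + \<rho> * ((u - v) \<bullet> (u - v))"
proof -
  define d where "d = norm D"
  define w where "w = norm (u - v)"
  have sq: "D \<bullet> D = d\<^sup>2" "(u - v) \<bullet> (u - v) = w\<^sup>2"
    by (simp_all add: d_def w_def power2_norm_eq_inner)
  have "(D *v (u - v)) \<bullet> u \<le> d * (norm u * w)"
    using abs_matrix_vector_inner_le[of D "u - v" u] by (simp add: d_def w_def mult_ac)
  also have "\<dots> \<le> \<mu> * d\<^sup>2 / 2 + (norm u * w)\<^sup>2 / (2 * \<mu>)"
  proof -
    \<comment> \<open>Completing the square, weighted by \<mu> so that exactly half of the viscous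
      term is spent.\<close>
    have "0 \<le> (\<mu> * d - norm u * w)\<^sup>2 / (2 * \<mu>)"
      using assms by simp
    also have "\<dots> = \<mu> * d\<^sup>2 / 2 + (norm u * w)\<^sup>2 / (2 * \<mu>) - d * (norm u * w)"
      using assms by (simp add: power2_eq_square field_simps)
    finally show ?thesis by simp
  qed
  also have "(norm u * w)\<^sup>2 / (2 * \<mu>) = (norm u)\<^sup>2 / (2 * \<mu>) * w\<^sup>2"
    by (simp add: power_mult_distrib)
  also have "\<dots> \<le> (\<beta> / 2 * norm u powr (r - 1) + \<rho>) * w\<^sup>2"
    unfolding \<rho> using assms by (intro mult_right_mono square_le_powr_plus_const) auto
  finally have B: "(D *v (u - v)) \<bullet> u \<le> \<mu> * d\<^sup>2 / 2 + (\<beta> / 2 * norm u powr (r - 1) + \<rho>) * w\<^sup>2"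
    by simp
  have "\<beta> * ((norm u powr (r - 1) + norm v powr (r - 1)) / 2 * w\<^sup>2)
      \<le> \<beta> * ((norm u powr (r - 1) *\<^sub>R u - norm v powr (r - 1) *\<^sub>R v) \<bullet> (u - v))"
    using inner_norm_powr_diff_ge[of "r - 1" u v] assms by (intro mult_left_mono) (auto simp: sq)
  moreover have "\<beta> * ((norm u powr (r - 1) + norm v powr (r - 1)) / 2 * w\<^sup>2)
      = \<beta> / 2 * norm u powr (r - 1) * w\<^sup>2 + \<beta> / 2 * norm v powr (r - 1) * w\<^sup>2"
    by (simp add: field_simps)
  moreover have "0 \<le> \<beta> / 2 * norm v powr (r - 1) * w\<^sup>2" "0 \<le> \<mu> * d\<^sup>2 / 2"
    using assms by auto
  ultimately show ?thesis
    using B unfolding sq by (simp add: distrib_right)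
qed

section \<open>The operators as bounded functionals\<close>

lemma norm_powr_in_Lp_space:
  assumes "s > 0" and u: "u \<in> Lp_space \<Omega> p"
  shows "(\<lambda>x. norm (u x) powr s) \<in> Lp_space \<Omega> (p / s)"
proof -
  note [measurable] = Lp_spaceD(1)[OF u]
  have "(\<lambda>x. norm (u x) powr s) \<in> borel_measurable (lebesgue_on \<Omega>)"
    by measurable
  then show ?thesis
    using assms Lp_spaceD(2)[OF u] by (simp add: Lp_space_def powr_powr)
qed

section \<open>Functionals on V and on the solenoidal Lebesgue space\<close>

lemma dual_spaceI:
  assumes "\<And>u v a b. u \<in> X \<Longrightarrow> v \<in> X \<Longrightarrow> l (\<lambda>x. a *\<^sub>R u x + b *\<^sub>R v x) = a * l u + b * l v"
    and "\<And>u. u \<in> X \<Longrightarrow> \<bar>l u\<bar> \<le> C * N u"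
  shows "l \<in> dual_space X N"
  using assms unfolding dual_space_def by blast

lemma dual_space_linear:
  assumes "l \<in> dual_space X N" "u \<in> X" "v \<in> X"
  shows "l (\<lambda>x. a *\<^sub>R u x + b *\<^sub>R v x) = a * l u + b * l v"
  using assms unfolding dual_space_def by blast

lemma dual_space_boundE:
  assumes "l \<in> dual_space X N"
  obtains C where "\<And>u. u \<in> X \<Longrightarrow> \<bar>l u\<bar> \<le> C * N u"
  using assms unfolding dual_space_def by blast

lemma dual_space_lincomb:
  assumes "l \<in> dual_space X N" "m \<in> dual_space X N"
  shows "(\<lambda>w. a * l w + b * m w) \<in> dual_space X N"
proof -
  obtain C where l: "\<And>u. u \<in> X \<Longrightarrow> \<bar>l u\<bar> \<le> C * N u"
    using dual_space_boundE[OF assms(1)] by blast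
  obtain C' where m: "\<And>u. u \<in> X \<Longrightarrow> \<bar>m u\<bar> \<le> C' * N u"
    using dual_space_boundE[OF assms(2)] by blast
  have "\<bar>a * l u + b * m u\<bar> \<le> (\<bar>a\<bar> * C + \<bar>b\<bar> * C') * N u" if "u \<in> X" for u
  proof -
    have "\<bar>a * l u + b * m u\<bar> \<le> \<bar>a\<bar> * \<bar>l u\<bar> + \<bar>b\<bar> * \<bar>m u\<bar>"
      using abs_triangle_ineq[of "a * l u" "b * m u"] by (simp add: abs_mult)
    also have "\<dots> \<le> \<bar>a\<bar> * (C * N u) + \<bar>b\<bar> * (C' * N u)"
      using l m that by (intro add_mono mult_left_mono) auto
    finally show ?thesis by (simp add: algebra_simps)
  qed
  moreover have "a * l (\<lambda>x. c *\<^sub>R u x + d *\<^sub>R v x) + b * m (\<lambda>x. c *\<^sub>R u x + d *\<^sub>R v x)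
      = c * (a * l u + b * m u) + d * (a * l v + b * m v)" if "u \<in> X" "v \<in> X" for u v c d
    unfolding dual_space_linear[OF assms(1) that] dual_space_linear[OF assms(2) that]
    by (simp add: algebra_simps)
  ultimately show ?thesis
    by (intro dual_spaceI)
qed

lemma integrable_inner_Lp_space:
  assumes pq: "p > 1" "q > 1" "1 / p + 1 / q = 1"
    and u: "u \<in> Lp_space \<Omega> p" and w: "w \<in> Lp_space \<Omega> q"
  shows "integrable (lebesgue_on \<Omega>) (\<lambda>x. u x \<bullet> w x)"
    and "\<bar>\<integral>x. u x \<bullet> w x \<partial>lebesgue_on \<Omega>\<bar> \<le> Lp_norm \<Omega> p u * Lp_norm \<Omega> q w"
proof -
  note [measurable] = Lp_spaceD(1)[OF u] Lp_spaceD(1)[OF w]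
  have le: "\<bar>u x \<bullet> w x\<bar> \<le> 1 * (norm (u x) * norm (w x))" for x
    by (simp add: Cauchy_Schwarz_ineq2)
  note H = Holder_Lp_bound[OF pq zero_le_one u w _ le]
  show "integrable (lebesgue_on \<Omega>) (\<lambda>x. u x \<bullet> w x)"
    by (rule H(1)) measurable
  show "\<bar>\<integral>x. u x \<bullet> w x \<partial>lebesgue_on \<Omega>\<bar> \<le> Lp_norm \<Omega> p u * Lp_norm \<Omega> q w"
    using H(2) by simp
qed

lemma V_spaceD:
  assumes "open \<Omega>" "w \<in> V_space \<Omega>"
  shows "wgrad \<Omega> w \<in> Lp_space \<Omega> 2" "wgrad \<Omega> w \<in> borel_measurable (lebesgue_on \<Omega>)"
  using assms V_space_subset_H1_space H1_spaceD(3) Lp_spaceD(1) by blast+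

lemma V_space_wgrad_lincomb:
  assumes "open \<Omega>" "u \<in> V_space \<Omega>" "v \<in> V_space \<Omega>"
  shows "AE x in lebesgue_on \<Omega>. wgrad \<Omega> (\<lambda>x. a *\<^sub>R u x + b *\<^sub>R v x) x = a *\<^sub>R wgrad \<Omega> u x + b *\<^sub>R wgrad \<Omega> v x"
  using assms V_space_subset_H1_space by (intro wgrad_lincomb) auto

lemma A_op_dual:
  assumes "open \<Omega>" "bounded \<Omega>" and D: "wgrad \<Omega> u \<in> Lp_space \<Omega> 2"
  shows "A_op \<Omega> u \<in> dual_space (V_space \<Omega>) (V_norm \<Omega>)"
proof (rule dual_spaceI)
  have pq: "(2::real) > 1" "1 / 2 + 1 / 2 = (1::real)" by auto
  note I = integrable_inner_Lp_space[OF pq(1,1,2) D V_spaceD(1)[OF \<open>open \<Omega>\<close>]]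
  fix v w a b assume v: "v \<in> V_space \<Omega>" and w: "w \<in> V_space \<Omega>"
  have vw: "(\<lambda>x. a *\<^sub>R v x + b *\<^sub>R w x) \<in> V_space \<Omega>"
    using v w by (rule fun_subspaceD[OF fun_subspace_V_space[OF assms(1,2)]])
  note [measurable] = Lp_spaceD(1)[OF D] V_spaceD(2)[OF \<open>open \<Omega>\<close> v] V_spaceD(2)[OF \<open>open \<Omega>\<close> w]
    V_spaceD(2)[OF \<open>open \<Omega>\<close> vw]
  have "A_op \<Omega> u (\<lambda>x. a *\<^sub>R v x + b *\<^sub>R w x)
      = (\<integral>x. a * (wgrad \<Omega> u x \<bullet> wgrad \<Omega> v x) + b * (wgrad \<Omega> u x \<bullet> wgrad \<Omega> w x) \<partial>lebesgue_on \<Omega>)"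
    unfolding A_op_def using V_space_wgrad_lincomb[OF \<open>open \<Omega>\<close> v w, of a b]
    by (intro integral_cong_AE) (auto elim!: eventually_mono simp: inner_add_right)
  then show "A_op \<Omega> u (\<lambda>x. a *\<^sub>R v x + b *\<^sub>R w x) = a * A_op \<Omega> u v + b * A_op \<Omega> u w"
    using I(1)[OF v] I(1)[OF w] by (simp add: A_op_def)
  show "\<bar>A_op \<Omega> u w\<bar> \<le> Lp_norm \<Omega> 2 (wgrad \<Omega> u) * V_norm \<Omega> w"
    using I(2)[OF w] by (simp add: A_op_def V_norm_def)
qed

text \<open>In \<open>B_form\<close> the derivative falls on w, and the remaining factor, of size at
  most the squared norm of u, is in L^2 because u is in L^4. Hence the L^2 norm of the gradient of w
  suffices for the bound.\<close>

lemma B_op_dual: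
  assumes "open \<Omega>" "bounded \<Omega>" "p \<ge> 4" and u: "u \<in> Lp_space \<Omega> p"
  shows "B_op \<Omega> u \<in> dual_space (V_space \<Omega>) (V_norm \<Omega>)"
proof -
  have fin: "\<Omega> \<in> lmeasurable" using assms by (simp add: lmeasurable_open)
  have "u \<in> Lp_space \<Omega> 4"
    using assms by (intro Lp_space_mono[OF fin _ _ u]) auto
  from norm_powr_in_Lp_space[OF _ this, of 2]
  have sq: "(\<lambda>x. norm (u x) powr 2) \<in> Lp_space \<Omega> 2" by simp
  define C where "C = Lp_norm \<Omega> 2 (\<lambda>x. norm (u x) powr 2)"
  note um[measurable] = Lp_spaceD(1)[OF u]
  have I: "integrable (lebesgue_on \<Omega>) (\<lambda>x. (wgrad \<Omega> w x *v u x) \<bullet> u x)"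
    "\<bar>B_op \<Omega> u w\<bar> \<le> C * V_norm \<Omega> w" if w: "w \<in> V_space \<Omega>" for w
  proof -
    note [measurable] = V_spaceD(2)[OF \<open>open \<Omega>\<close> w]
    have le: "\<bar>(wgrad \<Omega> w x *v u x) \<bullet> u x\<bar> \<le> 1 * (norm (wgrad \<Omega> w x) * norm (norm (u x) powr 2))" for x
      using abs_matrix_vector_inner_le[of "wgrad \<Omega> w x" "u x" "u x"]
      by (simp add: powr_numeral power2_eq_square mult_ac)
    show "integrable (lebesgue_on \<Omega>) (\<lambda>x. (wgrad \<Omega> w x *v u x) \<bullet> u x)"
      by (rule Holder_Lp_bound(1)[OF _ _ _ zero_le_one V_spaceD(1)[OF \<open>open \<Omega>\<close> w] sq _ le]) auto
    have "\<bar>\<integral>x. (wgrad \<Omega> w x *v u x) \<bullet> u x \<partial>lebesgue_on \<Omega>\<bar> \<le> 1 * (Lp_norm \<Omega> 2 (wgrad \<Omega> w) * C)"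
      unfolding C_def
      by (rule Holder_Lp_bound(2)[OF _ _ _ zero_le_one V_spaceD(1)[OF \<open>open \<Omega>\<close> w] sq _ le]) auto
    then show "\<bar>B_op \<Omega> u w\<bar> \<le> C * V_norm \<Omega> w"
      by (simp add: B_op_def B_form_def trilinear_form_def V_norm_def mult.commute)
  qed
  have "B_op \<Omega> u (\<lambda>x. a *\<^sub>R v x + b *\<^sub>R w x) = a * B_op \<Omega> u v + b * B_op \<Omega> u w"
    if v: "v \<in> V_space \<Omega>" and w: "w \<in> V_space \<Omega>" for v w a b
  proof -
    have vw: "(\<lambda>x. a *\<^sub>R v x + b *\<^sub>R w x) \<in> V_space \<Omega>"
      using v w by (rule fun_subspaceD[OF fun_subspace_V_space[OF assms(1,2)]])
    note [measurable] = V_spaceD(2)[OF \<open>open \<Omega>\<close> v] V_spaceD(2)[OF \<open>open \<Omega>\<close> w] V_spaceD(2)[OF \<open>open \<Omega>\<close> vw]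
    have "AE x in lebesgue_on \<Omega>. (wgrad \<Omega> (\<lambda>x. a *\<^sub>R v x + b *\<^sub>R w x) x *v u x) \<bullet> u x
        = a * ((wgrad \<Omega> v x *v u x) \<bullet> u x) + b * ((wgrad \<Omega> w x *v u x) \<bullet> u x)"
      using V_space_wgrad_lincomb[OF \<open>open \<Omega>\<close> v w, of a b]
      by eventually_elim (simp add: matrix_vector_mult_add_rdistrib inner_add_left scaleR_matrix_vector_assoc[symmetric])
    then have "(\<integral>x. (wgrad \<Omega> (\<lambda>x. a *\<^sub>R v x + b *\<^sub>R w x) x *v u x) \<bullet> u x \<partial>lebesgue_on \<Omega>)
        = (\<integral>x. a * ((wgrad \<Omega> v x *v u x) \<bullet> u x) + b * ((wgrad \<Omega> w x *v u x) \<bullet> u x) \<partial>lebesgue_on \<Omega>)"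
      by (intro integral_cong_AE) auto
    then show ?thesis
      using I(1)[OF v] I(1)[OF w] by (simp add: B_op_def B_form_def trilinear_form_def)
  qed
  then show ?thesis
    using I(2) by (rule dual_spaceI)
qed

text \<open>The r-th power of the norm of u lies in L^((r + 1)/r), whose exponent is conjugate to r
  + 1.\<close>

lemma integrable_C_op:
  assumes "r > 3" and u: "u \<in> Lp_space \<Omega> (r + 1)" and w: "w \<in> Lp_space \<Omega> (r + 1)"
  shows "integrable (lebesgue_on \<Omega>) (\<lambda>x. norm (u x) powr (r - 1) * (u x \<bullet> w x))"
    and "\<bar>C_op \<Omega> r u w\<bar> \<le> Lp_norm \<Omega> ((r + 1) / r) (\<lambda>x. norm (u x) powr r) * Lp_norm \<Omega> (r + 1) w"
proof -
  note [measurable] = Lp_spaceD(1)[OF u] Lp_spaceD(1)[OF w]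
  have pq: "(r + 1) / r > 1" "r + 1 > 1" "1 / ((r + 1) / r) + 1 / (r + 1) = 1"
    using assms(1) by (auto simp: field_simps)
  have ur: "(\<lambda>x. norm (u x) powr r) \<in> Lp_space \<Omega> ((r + 1) / r)"
    using assms(1) by (intro norm_powr_in_Lp_space u) simp
  have le: "\<bar>norm (u x) powr (r - 1) * (u x \<bullet> w x)\<bar> \<le> 1 * (norm (norm (u x) powr r) * norm (w x))" for x
  proof -
    have "\<bar>norm (u x) powr (r - 1) * (u x \<bullet> w x)\<bar> \<le> norm (u x) powr (r - 1) * (norm (u x) * norm (w x))"
      by (simp add: abs_mult Cauchy_Schwarz_ineq2 mult_left_mono)
    also have "norm (u x) powr (r - 1) * (norm (u x) * norm (w x)) = norm (u x) powr r * norm (w x)"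
      using powr_mult_base[of "norm (u x)" "r - 1"] by (simp add: mult_ac)
    finally show ?thesis by simp
  qed
  note H = Holder_Lp_bound[OF pq zero_le_one ur w _ le]
  show "integrable (lebesgue_on \<Omega>) (\<lambda>x. norm (u x) powr (r - 1) * (u x \<bullet> w x))"
    by (rule H(1)) measurable
  show "\<bar>C_op \<Omega> r u w\<bar> \<le> Lp_norm \<Omega> ((r + 1) / r) (\<lambda>x. norm (u x) powr r) * Lp_norm \<Omega> (r + 1) w"
    using H(2) by (simp add: C_op_def)
qed

lemma C_op_dual:
  assumes "r > 3" and u: "u \<in> Lp_space \<Omega> (r + 1)"
  shows "C_op \<Omega> r u \<in> dual_space (Lsol_space \<Omega> (r + 1)) (Lp_norm \<Omega> (r + 1))"
proof -
  have L: "w \<in> Lp_space \<Omega> (r + 1)" if "w \<in> Lsol_space \<Omega> (r + 1)" for w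
    using that Lsol_space_subset_Lp_space by blast
  have "C_op \<Omega> r u (\<lambda>x. a *\<^sub>R v x + b *\<^sub>R w x) = a * C_op \<Omega> r u v + b * C_op \<Omega> r u w"
    if v: "v \<in> Lsol_space \<Omega> (r + 1)" and w: "w \<in> Lsol_space \<Omega> (r + 1)" for v w a b
  proof -
    have "C_op \<Omega> r u (\<lambda>x. a *\<^sub>R v x + b *\<^sub>R w x) = (\<integral>x. a * (norm (u x) powr (r - 1) * (u x \<bullet> v x))
        + b * (norm (u x) powr (r - 1) * (u x \<bullet> w x)) \<partial>lebesgue_on \<Omega>)"
      by (simp add: C_op_def inner_add_right algebra_simps)
    then show ?thesis
      using integrable_C_op(1)[OF assms(1) u L[OF v]] integrable_C_op(1)[OF assms(1) u L[OF w]]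
      by (simp add: C_op_def)
  qed
  then show ?thesis
    using integrable_C_op(2)[OF assms(1) u L] by (rule dual_spaceI)
qed

text \<open>The identity is assigned to the dual of the Lebesgue space: there finite measure
  suffices, as it embeds L^(r + 1) in L^((r + 1)/r), whereas a bound by \<open>V_norm\<close>, which
  sees only the gradient, would call for the Poincare inequality.\<close>

lemma Id_op_dual:
  assumes fin: "\<Omega> \<in> lmeasurable" and "r > 3" and u: "u \<in> Lp_space \<Omega> (r + 1)"
  shows "Id_op \<Omega> u \<in> dual_space (Lsol_space \<Omega> (r + 1)) (Lp_norm \<Omega> (r + 1))"
proof -
  have L: "w \<in> Lp_space \<Omega> (r + 1)" if "w \<in> Lsol_space \<Omega> (r + 1)" for w
    using that Lsol_space_subset_Lp_space by blast
  have pq: "(r + 1) / r > 1" "r + 1 > 1" "1 / ((r + 1) / r) + 1 / (r + 1) = 1"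
    using assms(2) by (auto simp: field_simps)
  have "(r + 1) / r \<le> r + 1"
    using assms(2) by (simp add: divide_le_eq)
  then have u': "u \<in> Lp_space \<Omega> ((r + 1) / r)"
    using assms(2) by (intro Lp_space_mono[OF fin _ _ u]) auto
  note I = integrable_inner_Lp_space[OF pq u' L]
  have "Id_op \<Omega> u (\<lambda>x. a *\<^sub>R v x + b *\<^sub>R w x) = a * Id_op \<Omega> u v + b * Id_op \<Omega> u w"
    if v: "v \<in> Lsol_space \<Omega> (r + 1)" and w: "w \<in> Lsol_space \<Omega> (r + 1)" for v w a b
    using I(1)[OF v] I(1)[OF w] by (simp add: Id_op_def inner_add_right)
  then show ?thesis
    using I(2)[folded Id_op_def] by (rule dual_spaceI)
qed

lemma VL_dual_sum_subset_dual_space: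
  assumes "open \<Omega>" "bounded \<Omega>" "p \<ge> 1"
  shows "VL_dual_sum \<Omega> p \<subseteq> dual_space (VL_space \<Omega> p) (VL_norm \<Omega> p)"
proof
  fix l assume "l \<in> VL_dual_sum \<Omega> p"
  then obtain l1 l2 where l1: "l1 \<in> dual_space (V_space \<Omega>) (V_norm \<Omega>)"
    and l2: "l2 \<in> dual_space (Lsol_space \<Omega> p) (Lp_norm \<Omega> p)"
    and l: "\<And>w. w \<in> VL_space \<Omega> p \<Longrightarrow> l w = l1 w + l2 w"
    unfolding VL_dual_sum_def by blast
  obtain C1 where C1: "\<And>w. w \<in> V_space \<Omega> \<Longrightarrow> \<bar>l1 w\<bar> \<le> C1 * V_norm \<Omega> w"
    using dual_space_boundE[OF l1] by blast
  obtain C2 where C2: "\<And>w. w \<in> Lsol_space \<Omega> p \<Longrightarrow> \<bar>l2 w\<bar> \<le> C2 * Lp_norm \<Omega> p w"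
    using dual_space_boundE[OF l2] by blast
  have "\<bar>l w\<bar> \<le> (\<bar>C1\<bar> + \<bar>C2\<bar>) * VL_norm \<Omega> p w" if w: "w \<in> VL_space \<Omega> p" for w
  proof -
    have "\<bar>l w\<bar> \<le> C1 * V_norm \<Omega> w + C2 * Lp_norm \<Omega> p w"
      using C1[of w] C2[of w] w l[OF w] by (auto simp: VL_space_def)
    \<comment> \<open>The constants in \<open>dual_space\<close> may be negative, hence the absolute
      values.\<close>
    also have "\<dots> \<le> \<bar>C1\<bar> * VL_norm \<Omega> p w + \<bar>C2\<bar> * VL_norm \<Omega> p w"
      by (intro add_mono mult_mono) (auto simp: VL_norm_def V_norm_def Lp_norm_nonneg)
    finally show ?thesis by (simp add: distrib_right)
  qed
  moreover have "l (\<lambda>x. a *\<^sub>R v x + b *\<^sub>R w x) = a * l v + b * l w"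
    if v: "v \<in> VL_space \<Omega> p" and w: "w \<in> VL_space \<Omega> p" for v w a b
  proof -
    have "l (\<lambda>x. a *\<^sub>R v x + b *\<^sub>R w x) = l1 (\<lambda>x. a *\<^sub>R v x + b *\<^sub>R w x) + l2 (\<lambda>x. a *\<^sub>R v x + b *\<^sub>R w x)"
      using v w by (intro l fun_subspaceD[OF fun_subspace_VL_space[OF assms]])
    then show ?thesis
      using l[OF v] l[OF w] v w by (simp add: VL_space_def dual_space_linear[OF l1] dual_space_linear[OF l2] algebra_simps)
  qed
  ultimately show "l \<in> dual_space (VL_space \<Omega> p) (VL_norm \<Omega> p)"
    by (intro dual_spaceI)
qed

lemma G_op_in_VL_dual_sum:
  assumes "open \<Omega>" "bounded \<Omega>" "r > 3" and u: "u \<in> VL_space \<Omega> (r + 1)"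
  shows "(\<lambda>w. G_op \<Omega> \<mu> \<beta> r u w + \<rho> * Id_op \<Omega> u w) \<in> VL_dual_sum \<Omega> (r + 1)"
proof -
  note u' = VL_spaceD[OF \<open>open \<Omega>\<close> u]
  have fin: "\<Omega> \<in> lmeasurable" using assms by (simp add: lmeasurable_open)
  have VL1: "(\<lambda>w. \<mu> * A_op \<Omega> u w + 1 * B_op \<Omega> u w) \<in> dual_space (V_space \<Omega>) (V_norm \<Omega>)"
    using assms u' by (intro dual_space_lincomb A_op_dual B_op_dual[where p="r + 1"]) auto
  have VL2: "(\<lambda>w. \<beta> * C_op \<Omega> r u w + \<rho> * Id_op \<Omega> u w) \<in> dual_space (Lsol_space \<Omega> (r + 1)) (Lp_norm \<Omega> (r + 1))"
    using assms u' fin by (intro dual_space_lincomb C_op_dual Id_op_dual) auto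
  show ?thesis
    unfolding VL_dual_sum_def
    by (intro CollectI bexI[OF _ VL1] bexI[OF _ VL2] ballI) (simp add: G_op_def)
qed

section \<open>Monotonicity\<close>

lemma G_op_monotone:
  fixes \<Omega> :: "(real^'n) set" and \<mu> \<beta> r \<rho> :: real
  assumes "open \<Omega>" "bounded \<Omega>" and par: "\<mu> > 0" "\<beta> > 0" "r > 3"
    and \<rho>: "\<rho> = (r - 3) / (2 * \<mu> * (r - 1)) * (2 / (\<beta> * \<mu> * (r - 1))) powr (2 / (r - 3))"
    and u: "u \<in> VL_space \<Omega> (r + 1)" and v: "v \<in> VL_space \<Omega> (r + 1)"
  defines "w \<equiv> \<lambda>x. u x - v x"
  shows "G_op \<Omega> \<mu> \<beta> r u w - G_op \<Omega> \<mu> \<beta> r v w + \<rho> * (\<integral>x. w x \<bullet> w x \<partial>lebesgue_on \<Omega>) \<ge> 0"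
proof -
  let ?M = "lebesgue_on \<Omega>"
  have fin: "\<Omega> \<in> lmeasurable" using assms by (simp add: lmeasurable_open)
  have p: "r + 1 \<ge> 4" using par by simp
  have w: "w \<in> VL_space \<Omega> (r + 1)"
    unfolding w_def using assms by (intro fun_subspace_diff[OF fun_subspace_VL_space] u v) auto
  note u' = VL_spaceD[OF \<open>open \<Omega>\<close> u] and v' = VL_spaceD[OF \<open>open \<Omega>\<close> v] and w' = VL_spaceD[OF \<open>open \<Omega>\<close> w]
  note [measurable] = u'(5,6) v'(5,6) w'(5,6)
  define D where "D = wgrad \<Omega> w"
  have DL: "D \<in> Lp_space \<Omega> 2" and [measurable]: "D \<in> borel_measurable ?M"
    using w' by (auto simp: D_def)
  have inner2: "integrable ?M (\<lambda>x. f x \<bullet> g x)" if "f \<in> Lp_space \<Omega> 2" "g \<in> Lp_space \<Omega> 2"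
    for f g :: "real^'n \<Rightarrow> 'b::euclidean_space"
    by (rule integrable_inner_Lp_space(1)[OF _ _ _ that]) auto
  note T = integrable_trilinear(1)[OF fin p DL]
  have A: "A_op \<Omega> u w - A_op \<Omega> v w = (\<integral>x. D x \<bullet> D x \<partial>?M)"
  proof -
    \<comment> \<open>Linearity of the gradient enters here: \<open>A_op\<close> takes the gradients
      of u and v separately, whereas \<open>B_op\<close> differentiates only its test argument,
      which is w in both terms.\<close>
    have "AE x in ?M. D x = wgrad \<Omega> u x - wgrad \<Omega> v x"
      using wgrad_lincomb[OF \<open>open \<Omega>\<close> u'(3) v'(3), of 1 "-1"] by (simp add: D_def w_def)
    then have "(\<integral>x. D x \<bullet> D x \<partial>?M) = (\<integral>x. wgrad \<Omega> u x \<bullet> D x - wgrad \<Omega> v x \<bullet> D x \<partial>?M)"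
      by (intro integral_cong_AE) (auto elim!: eventually_mono simp: inner_diff_left)
    then show ?thesis
      using inner2[OF u'(7) DL] inner2[OF v'(7) DL] by (simp add: A_op_def D_def)
  qed
  have B: "B_op \<Omega> u w - B_op \<Omega> v w = - (\<integral>x. (D x *v w x) \<bullet> u x \<partial>?M)"
  proof -
    \<comment> \<open>First u = w + v is substituted in the argument of \<open>D x\<close>, then in
      the second factor of the term with v; the last summand is the integrand of \<open>B_op\<close>
      at v.\<close>
    have "(D x *v u x) \<bullet> u x = (D x *v w x) \<bullet> u x + (D x *v v x) \<bullet> w x + (D x *v v x) \<bullet> v x" for x
      by (simp add: w_def matrix_vector_mult_diff_distrib inner_diff_left inner_diff_right)
    then have "(\<integral>x. (D x *v u x) \<bullet> u x \<partial>?M) = (\<integral>x. (D x *v w x) \<bullet> u x \<partial>?M)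
        + (\<integral>x. (D x *v v x) \<bullet> w x \<partial>?M) + (\<integral>x. (D x *v v x) \<bullet> v x \<partial>?M)"
      using T[OF w'(4) u'(4)] T[OF v'(4) w'(4)] T[OF v'(4) v'(4)] by simp
    moreover have "(\<integral>x. (D x *v v x) \<bullet> w x \<partial>?M) = 0"
      using trilinear_form_diagonal_eq_0[OF assms(1,2) p v'(2) w] by (simp add: trilinear_form_def D_def)
    ultimately show ?thesis
      by (simp add: B_op_def B_form_def trilinear_form_def D_def)
  qed
  note iC = integrable_C_op(1)[OF \<open>r > 3\<close> u'(4) w'(4)] integrable_C_op(1)[OF \<open>r > 3\<close> v'(4) w'(4)]
  define c where "c x = (norm (u x) powr (r - 1) *\<^sub>R u x - norm (v x) powr (r - 1) *\<^sub>R v x) \<bullet> w x" for x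
  have c_eq: "c x = norm (u x) powr (r - 1) * (u x \<bullet> w x) - norm (v x) powr (r - 1) * (v x \<bullet> w x)" for x
    by (simp add: c_def inner_diff_left)
  have ic: "integrable ?M c" unfolding c_eq[abs_def] using iC by simp
  have C: "C_op \<Omega> r u w - C_op \<Omega> r v w = (\<integral>x. c x \<partial>?M)"
    unfolding c_eq using iC by (simp add: C_op_def)
  have iw: "integrable ?M (\<lambda>x. w x \<bullet> w x)"
    by (rule inner2) (use H1_spaceD(1)[OF \<open>open \<Omega>\<close> w'(3)] in auto)
  \<comment> \<open>The integrand is nonnegative at every point, since
    \<open>pointwise_monotonicity\<close> holds for any matrix and thus for whichever representative
    \<open>wgrad\<close> selects.\<close>
  have "0 \<le> (\<integral>x. \<mu> * (D x \<bullet> D x) - (D x *v w x) \<bullet> u x + \<beta> * c x + \<rho> * (w x \<bullet> w x) \<partial>?M)"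
    unfolding c_def w_def by (intro integral_nonneg_AE AE_I2 pointwise_monotonicity par \<rho>)
  also have "\<dots> = \<mu> * (\<integral>x. D x \<bullet> D x \<partial>?M) - (\<integral>x. (D x *v w x) \<bullet> u x \<partial>?M)
      + \<beta> * (\<integral>x. c x \<partial>?M) + \<rho> * (\<integral>x. w x \<bullet> w x \<partial>?M)"
    using inner2[OF DL DL] T[OF w'(4) u'(4)] ic iw by simp
  also have "\<dots> = G_op \<Omega> \<mu> \<beta> r u w - G_op \<Omega> \<mu> \<beta> r v w + \<rho> * (\<integral>x. w x \<bullet> w x \<partial>?M)"
    unfolding A[symmetric] C[symmetric] G_op_def using B by (simp add: algebra_simps)
  finally show ?thesis .
qed

lemma Id_op_diff:
  assumes "open \<Omega>" "u \<in> VL_space \<Omega> p" "v \<in> VL_space \<Omega> p"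
  shows "Id_op \<Omega> u (\<lambda>x. u x - v x) - Id_op \<Omega> v (\<lambda>x. u x - v x)
    = (\<integral>x. (u x - v x) \<bullet> (u x - v x) \<partial>lebesgue_on \<Omega>)"
proof -
  have u: "u \<in> Lp_space \<Omega> 2" and v: "v \<in> Lp_space \<Omega> 2"
    using assms VL_spaceD(3) H1_spaceD(1) by blast+
  have w: "(\<lambda>x. u x - v x) \<in> Lp_space \<Omega> 2"
    by (rule fun_subspace_diff[OF fun_subspace_Lp_space u v]) simp
  have "integrable (lebesgue_on \<Omega>) (\<lambda>x. u x \<bullet> (u x - v x))" "integrable (lebesgue_on \<Omega>) (\<lambda>x. v x \<bullet> (u x - v x))"
    by (rule integrable_inner_Lp_space(1)[OF _ _ _ u w], simp_all)
      (rule integrable_inner_Lp_space(1)[OF _ _ _ v w], simp_all)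
  then show ?thesis
    unfolding Id_op_def inner_diff_left[of "u _" "v _"] by simp
qed

theorem theorem2p5:
  fixes \<Omega> :: "(real^'n) set" and \<mu> \<beta> r \<rho> :: real
  assumes "2 \<le> CARD('n)" and "CARD('n) \<le> 4"
    and "bounded_C2_domain \<Omega>"
    and "\<mu> > 0" and "\<beta> > 0" and "r > 3"
    and "\<rho> = (r - 3) / (2 * \<mu> * (r - 1)) * (2 / (\<beta> * \<mu> * (r - 1))) powr (2 / (r - 3))"
  shows "(\<forall>u \<in> VL_space \<Omega> (r + 1). \<forall>v \<in> VL_space \<Omega> (r + 1).
            G_op \<Omega> \<mu> \<beta> r u (\<lambda>x. u x - v x) - G_op \<Omega> \<mu> \<beta> r v (\<lambda>x. u x - v x)
              + \<rho> * (H_norm \<Omega> (\<lambda>x. u x - v x))\<^sup>2 \<ge> 0)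
       \<and> (\<forall>u \<in> VL_space \<Omega> (r + 1).
            (\<lambda>w. G_op \<Omega> \<mu> \<beta> r u w + \<rho> * Id_op \<Omega> u w) \<in> VL_dual_sum \<Omega> (r + 1))
       \<and> monotone_operator (VL_space \<Omega> (r + 1)) (VL_norm \<Omega> (r + 1))
            (\<lambda>u w. G_op \<Omega> \<mu> \<beta> r u w + \<rho> * Id_op \<Omega> u w)"
proof -
  have dom: "open \<Omega>" "bounded \<Omega>"
    using assms(3) by (auto simp: bounded_C2_domain_def)
  note mono = G_op_monotone[OF dom assms(4-7)]
  have dual: "(\<lambda>w. G_op \<Omega> \<mu> \<beta> r u w + \<rho> * Id_op \<Omega> u w) \<in> VL_dual_sum \<Omega> (r + 1)"
    if "u \<in> VL_space \<Omega> (r + 1)" for u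
    using dom assms(6) that by (rule G_op_in_VL_dual_sum)
  have "monotone_operator (VL_space \<Omega> (r + 1)) (VL_norm \<Omega> (r + 1))
      (\<lambda>u w. G_op \<Omega> \<mu> \<beta> r u w + \<rho> * Id_op \<Omega> u w)"
    unfolding monotone_operator_def
  proof (intro conjI ballI)
    fix u assume u: "u \<in> VL_space \<Omega> (r + 1)"
    then show "(\<lambda>w. G_op \<Omega> \<mu> \<beta> r u w + \<rho> * Id_op \<Omega> u w) \<in> dual_space (VL_space \<Omega> (r + 1)) (VL_norm \<Omega> (r + 1))"
      using dual VL_dual_sum_subset_dual_space[OF dom, of "r + 1"] assms(6) by auto
    fix v assume v: "v \<in> VL_space \<Omega> (r + 1)"
    show "0 \<le> G_op \<Omega> \<mu> \<beta> r u (\<lambda>x. u x - v x) + \<rho> * Id_op \<Omega> u (\<lambda>x. u x - v x)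
        - (G_op \<Omega> \<mu> \<beta> r v (\<lambda>x. u x - v x) + \<rho> * Id_op \<Omega> v (\<lambda>x. u x - v x))"
      using mono[OF u v] unfolding Id_op_diff[OF dom(1) u v, symmetric]
      by (simp add: algebra_simps)
  qed
  then show ?thesis
    using mono dual by (simp add: H_norm_def Lp_norm_2_squared)
qed

end
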